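(* Let $A\in\mathbb{C}^{n\times n}$ be positive definite (i.e. $A+A^*$ is Hermitian positive definite), let $C\in\mathbb{C}^{m\times m}$ be positive semidefinite (i.e. $C+C^*$ is Hermitian positive semidefinite), let $B\in\mathbb{C}^{m\times n}$ with $m\le n$, and let $$\mathcal{A}=\begin{bmatrix}A&B^*\\-B&C\end{bmatrix}$$ be singular, with linear system $\mathcal{A}u=b$. Write $A=A_P+A_S$ with $A_P$ positive definite and $A_S$ skew-Hermitian, $C=C_P+C_S$ with $C_P$ positive semidefinite and $C_S$ skew-Hermitian, and $B=B_P+B_S$ an arbitrary splitting. Let $P_\alpha\in\mathbb{C}^{n\times n}$ and $P_\beta\in\mathbb{C}^{m\times m}$ be Hermitian positive definite, and set $$\mathcal{P}=\begin{bmatrix}A_P&B_P^*\\-B_P&C_P\end{bmatrix},\quad \mathcal{S}=\begin{bmatrix}A_S&B_S^*\\-B_S&C_S\end{bmatrix},\quad \Sigma=\begin{bmatrix}P_\alpha&0\\0&P_\beta\end{bmatrix},$$ $$\Gamma_{\mathrm{EPSS}}=(\Sigma+\mathcal{S})^{-1}(\Sigma-\mathcal{P})(\Sigma+\mathcal{P})^{-1}(\Sigma-\mathcal{S}).$$ Suppose that for every $\lambda\in\sigma(\Gamma_{\mathrm{EPSS}})$ with $|\lambda|=1$ and $\lambda\neq 1$, and for every nonzero $r\in \mathrm{null}(C+C^* )$, $$r^*\big(P_\beta-B_SP_\alpha^{-1}B_P^*+C_SP_\beta^{-1}C_P\big)r\neq\frac{1+\lambda}{1-\lambda}\,r^*Cr.$$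 Then the EPSS iteration $u^{k+1}=\Gamma_{\mathrm{EPSS}}u^k+c$, with $c=2(\Sigma+\mathcal{S})^{-1}\Sigma(\Sigma+\mathcal{P})^{-1}b$, is semi-convergent, i.e. it converges to a solution of $\mathcal{A}u=b$ for every initial guess $u^0$.
   Context: The EPSS iteration is equivalently the two-step scheme $(\Sigma+\mathcal{P})u^{k+1/2}=(\Sigma-\mathcal{S})u^k+b$, $(\Sigma+\mathcal{S})u^{k+1}=(\Sigma-\mathcal{P})u^{k+1/2}+b$. $\sigma(\cdot)$ denotes the spectrum and $\mathrm{null}(\cdot)$ the null space. An iteration for a singular system is called semi-convergent if it converges to a solution of the system for any initial guess; the system $\mathcal{A}u=b$ is understood to be consistent (solvable). *)

theory Defs
  imports "Jordan_Normal_Form.Spectral_Radius" "Jordan_Normal_Form.Gauss_Jordan_Elimination"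
    "Jordan_Normal_Form.Schur_Decomposition"
begin

(* Hermitian positive definite / semidefinite n x n complex matrices *)
definition hpd_mat :: "nat \<Rightarrow> complex mat \<Rightarrow> bool" where
  "hpd_mat n H \<longleftrightarrow> H \<in> carrier_mat n n \<and> mat_adjoint H = H \<and>
     (\<forall>x \<in> carrier_vec n. x \<noteq> 0\<^sub>v n \<longrightarrow> Re ((H *\<^sub>v x) \<bullet>c x) > 0)"

definition hpsd_mat :: "nat \<Rightarrow> complex mat \<Rightarrow> bool" where
  "hpsd_mat n H \<longleftrightarrow> H \<in> carrier_mat n n \<and> mat_adjoint H = H \<and>
     (\<forall>x \<in> carrier_vec n. Re ((H *\<^sub>v x) \<bullet>c x) \<ge> 0)"

(* paper's convention: M positive (semi)definite iff M + M^* is Hermitian positive (semi)definite *)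
definition pd_mat :: "nat \<Rightarrow> complex mat \<Rightarrow> bool" where
  "pd_mat n M \<longleftrightarrow> M \<in> carrier_mat n n \<and> hpd_mat n (M + mat_adjoint M)"

definition psd_mat :: "nat \<Rightarrow> complex mat \<Rightarrow> bool" where
  "psd_mat n M \<longleftrightarrow> M \<in> carrier_mat n n \<and> hpsd_mat n (M + mat_adjoint M)"

definition skew_herm_mat :: "nat \<Rightarrow> complex mat \<Rightarrow> bool" where
  "skew_herm_mat n M \<longleftrightarrow> M \<in> carrier_mat n n \<and> mat_adjoint M = - M"

(* matrix inverse (of an invertible square matrix) *)
definition minv :: "complex mat \<Rightarrow> complex mat" where
  "minv M = the (mat_inverse M)"

(* k-th iterate of u^{k+1} = G u^k + c starting at u0 *)
definition lin_iter :: "complex mat \<Rightarrow> complex vec \<Rightarrow> complex vec \<Rightarrow> nat \<Rightarrow> complex vec" where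
  "lin_iter G c u0 k = ((\<lambda>u. G *\<^sub>v u + c) ^^ k) u0"

end

(*
  Write Gamma = (Sigma + S)^-1 (Sigma - P) (Sigma + P)^-1 (Sigma - S) with Sigma Hermitian positive definite,
  P with positive semidefinite Hermitian part and S skew-Hermitian.  In the energy E u = |(Sigma + S) u|^2,
  measured in the norm of Sigma^-1, one step of the iteration loses exactly 4 Re <P h, h>, where
  h = (Sigma + P)^-1 (Sigma - S) u is the half step.  Hence the spectrum of Gamma lies in the closed unit disc,
  the eigenvalue 1 is semisimple (along a Jordan chain the energy would grow quadratically), and an eigenvector
  for an eigenvalue on the unit circle has Re <P h, h> = 0.  For the saddle point splitting this forces h to
  vanish in the first block and its second block r into the kernel of C + C^*; eliminating the first block of
  the eigenvector then gives (P_beta - B_S P_alpha^-1 B_P^* + C_S P_beta^-1 C_P) r = (1 + lambda)/(1 - lambda) C r,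
  which the hypothesis rules out unless lambda = 1.  A matrix whose spectrum lies in the open unit disc apart
  from a semisimple eigenvalue 1 is semi-convergent, its limits are fixed points, and the fixed points of the
  iteration are exactly the solutions of the system.
*)
theory Submission
  imports Defs
begin

section \<open>Matrices, vectors and the complex inner product\<close>

lemma mult_mat_vec_zero: "A \<in> carrier_mat nr nc \<Longrightarrow> A *\<^sub>v 0\<^sub>v nc = 0\<^sub>v nr"
  by (intro eq_vecI) auto

lemmas mult_mat_vec_zero_square [simp] = mult_mat_vec_zero[of _ n n for n]

lemma smult_zero_vec [simp]: "(k :: 'a :: semiring_0) \<cdot>\<^sub>v 0\<^sub>v n = 0\<^sub>v n"
  by (intro eq_vecI) auto

lemma smult_mat_mult_vec:
  "(A :: 'a :: comm_ring mat) \<in> carrier_mat nr nc \<Longrightarrow> v \<in> carrier_vec nc \<Longrightarrow> (k \<cdot>\<^sub>m A) *\<^sub>v v = k \<cdot>\<^sub>v (A *\<^sub>v v)"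
  by (intro eq_vecI) (auto simp: scalar_prod_def sum_distrib_left mult.assoc)

lemma vec_diff_eq_zero_iff:
  "(x :: 'a :: ab_group_add vec) \<in> carrier_vec n \<Longrightarrow> y \<in> carrier_vec n \<Longrightarrow> x - y = 0\<^sub>v n \<longleftrightarrow> x = y"
  by (auto simp: vec_eq_iff)

lemma append_vec_diff:
  assumes "(x :: 'a :: ab_group_add vec) \<in> carrier_vec n" "x' \<in> carrier_vec n" "y \<in> carrier_vec m" "y' \<in> carrier_vec m"
  shows "(x @\<^sub>v y) - (x' @\<^sub>v y') = (x - x') @\<^sub>v (y - y')"
  using assms by (intro eq_vecI) auto

lemma smult_append_vec:
  "(x :: 'a :: comm_ring vec) \<in> carrier_vec n \<Longrightarrow> y \<in> carrier_vec m \<Longrightarrow> a \<cdot>\<^sub>v (x @\<^sub>v y) = (a \<cdot>\<^sub>v x) @\<^sub>v (a \<cdot>\<^sub>v y)"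
  by (intro eq_vecI) auto

lemma smult_vec_eq_imp_eq_divide:
  assumes "(a :: 'a :: field) \<noteq> 0" and "a \<cdot>\<^sub>v x = b \<cdot>\<^sub>v y"
  shows "x = (b / a) \<cdot>\<^sub>v y"
proof -
  have "x = (1 / a) \<cdot>\<^sub>v (a \<cdot>\<^sub>v x)" using assms(1) by (simp add: smult_smult_assoc)
  also have "\<dots> = (b / a) \<cdot>\<^sub>v y" unfolding assms(2) by (simp add: smult_smult_assoc)
  finally show ?thesis .
qed

lemma solve_sum_diff_vec:
  fixes p s q r :: "'a :: field vec"
  assumes "p \<in> carrier_vec n" "s \<in> carrier_vec n" "q \<in> carrier_vec n" "r \<in> carrier_vec n"
    and diff: "p - s = q + r" and sum: "a \<cdot>\<^sub>v (p + s) = q - r"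
  shows "(2 * a) \<cdot>\<^sub>v p = (a + 1) \<cdot>\<^sub>v q + (a - 1) \<cdot>\<^sub>v r"
    and "(2 * a) \<cdot>\<^sub>v s = (1 - a) \<cdot>\<^sub>v q - (1 + a) \<cdot>\<^sub>v r"
proof -
  have e: "p $ i - s $ i = q $ i + r $ i" "a * (p $ i + s $ i) = q $ i - r $ i" if "i < n" for i
    using arg_cong[OF diff, of "\<lambda>v. v $ i"] arg_cong[OF sum, of "\<lambda>v. v $ i"] that assms(1-4) by simp_all
  have "2 * a * p $ i = a * (p $ i + s $ i) + a * (p $ i - s $ i)"
    "2 * a * s $ i = a * (p $ i + s $ i) - a * (p $ i - s $ i)" for i
    by (simp_all add: algebra_simps)
  then show "(2 * a) \<cdot>\<^sub>v p = (a + 1) \<cdot>\<^sub>v q + (a - 1) \<cdot>\<^sub>v r" "(2 * a) \<cdot>\<^sub>v s = (1 - a) \<cdot>\<^sub>v q - (1 + a) \<cdot>\<^sub>v r"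
    using e assms(1-4) by (auto intro!: eq_vecI simp: algebra_simps)
qed

lemma mat_adjoint_dim [simp]:
  "dim_row (mat_adjoint A) = dim_col A" "dim_col (mat_adjoint A) = dim_row A"
  unfolding mat_adjoint_def by (auto simp: mat_of_rows_def)

lemma mat_adjoint_carrier [simp]:
  "A \<in> carrier_mat nr nc \<Longrightarrow> mat_adjoint A \<in> carrier_mat nc nr"
  by auto

lemma mat_adjoint_index [simp]:
  "i < dim_col A \<Longrightarrow> j < dim_row A \<Longrightarrow> mat_adjoint A $$ (i, j) = conjugate (A $$ (j, i))"
  unfolding mat_adjoint_def by (auto simp: mat_of_rows_def)

lemma mat_adjoint_adjoint [simp]: "mat_adjoint (mat_adjoint A) = A"
  by (rule eq_matI) auto

lemma mat_adjoint_add: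
  "A \<in> carrier_mat nr nc \<Longrightarrow> B \<in> carrier_mat nr nc \<Longrightarrow>
    mat_adjoint (A + B) = mat_adjoint A + mat_adjoint B"
  by (rule eq_matI) (auto simp: conjugate_dist_add)

lemma mat_adjoint_zero [simp]: "mat_adjoint (0\<^sub>m nr nc) = 0\<^sub>m nc nr"
  by (rule eq_matI) auto

lemma mat_adjoint_four_block_mat:
  assumes "A \<in> carrier_mat n1 m1" "B \<in> carrier_mat n1 m2" "C \<in> carrier_mat n2 m1" "D \<in> carrier_mat n2 m2"
  shows "mat_adjoint (four_block_mat A B C D) =
    four_block_mat (mat_adjoint A) (mat_adjoint C) (mat_adjoint B) (mat_adjoint D)"
  using assms by (intro eq_matI) auto

lemma cscalar_prod_add_left:
  "(x :: complex vec) \<in> carrier_vec n \<Longrightarrow> y \<in> carrier_vec n \<Longrightarrow> z \<in> carrier_vec n \<Longrightarrow>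
    (x + y) \<bullet>c z = x \<bullet>c z + y \<bullet>c z"
  by (auto simp: scalar_prod_def sum.distrib algebra_simps)

lemma cscalar_prod_add_right:
  "(x :: complex vec) \<in> carrier_vec n \<Longrightarrow> y \<in> carrier_vec n \<Longrightarrow> z \<in> carrier_vec n \<Longrightarrow>
    x \<bullet>c (y + z) = x \<bullet>c y + x \<bullet>c z"
  by (auto simp: scalar_prod_def sum.distrib algebra_simps)

lemma cscalar_prod_minus_left:
  "(x :: complex vec) \<in> carrier_vec n \<Longrightarrow> y \<in> carrier_vec n \<Longrightarrow> z \<in> carrier_vec n \<Longrightarrow>
    (x - y) \<bullet>c z = x \<bullet>c z - y \<bullet>c z"
  by (auto simp: scalar_prod_def sum_subtractf algebra_simps)

lemma cscalar_prod_minus_right: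
  "(x :: complex vec) \<in> carrier_vec n \<Longrightarrow> y \<in> carrier_vec n \<Longrightarrow> z \<in> carrier_vec n \<Longrightarrow>
    x \<bullet>c (y - z) = x \<bullet>c y - x \<bullet>c z"
  by (auto simp: scalar_prod_def sum_subtractf algebra_simps)

lemma cscalar_prod_uminus_left:
  "(x :: complex vec) \<in> carrier_vec n \<Longrightarrow> y \<in> carrier_vec n \<Longrightarrow> (- x) \<bullet>c y = - (x \<bullet>c y)"
  by (auto simp: scalar_prod_def sum_negf[symmetric])

lemma cscalar_prod_smult_left:
  "(x :: complex vec) \<in> carrier_vec n \<Longrightarrow> y \<in> carrier_vec n \<Longrightarrow> (k \<cdot>\<^sub>v x) \<bullet>c y = k * (x \<bullet>c y)"
  by (auto simp: scalar_prod_def sum_distrib_left algebra_simps)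

lemma cscalar_prod_smult_right:
  "(x :: complex vec) \<in> carrier_vec n \<Longrightarrow> y \<in> carrier_vec n \<Longrightarrow> x \<bullet>c (k \<cdot>\<^sub>v y) = cnj k * (x \<bullet>c y)"
  by (auto simp: scalar_prod_def sum_distrib_left algebra_simps)

lemma cscalar_prod_swap:
  "(x :: complex vec) \<in> carrier_vec n \<Longrightarrow> y \<in> carrier_vec n \<Longrightarrow> x \<bullet>c y = cnj (y \<bullet>c x)"
  by (auto simp: scalar_prod_def atLeast0LessThan mult.commute intro!: sum.cong)

lemma cscalar_prod_append:
  assumes "(x :: complex vec) \<in> carrier_vec n1" "x' \<in> carrier_vec n1" "y \<in> carrier_vec n2" "y' \<in> carrier_vec n2"
  shows "(x @\<^sub>v y) \<bullet>c (x' @\<^sub>v y') = x \<bullet>c x' + y \<bullet>c y'"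
proof -
  have "conjugate (x' @\<^sub>v y') = conjugate x' @\<^sub>v conjugate y'"
    using assms by (intro eq_vecI) auto
  then show ?thesis using scalar_prod_append[of x n1 y n2 "conjugate x'" "conjugate y'"] assms by simp
qed

lemma cscalar_prod_mat_adjoint:
  assumes A: "(A :: complex mat) \<in> carrier_mat nr nc" and x: "x \<in> carrier_vec nc" and y: "y \<in> carrier_vec nr"
  shows "(A *\<^sub>v x) \<bullet>c y = x \<bullet>c (mat_adjoint A *\<^sub>v y)"
proof -
  have "(A *\<^sub>v x) \<bullet>c y = (\<Sum>i<nr. (\<Sum>j<nc. A $$ (i,j) * x $ j) * cnj (y $ i))"
    using A x y by (auto simp: scalar_prod_def mult_mat_vec_def row_def atLeast0LessThan intro!: sum.cong)
  also have "\<dots> = (\<Sum>j<nc. x $ j * cnj (\<Sum>i<nr. cnj (A $$ (i,j)) * y $ i))"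
    unfolding cnj_sum sum_distrib_left sum_distrib_right by (subst sum.swap) (simp add: mult_ac)
  also have "\<dots> = x \<bullet>c (mat_adjoint A *\<^sub>v y)"
    using A x y by (auto simp: scalar_prod_def mult_mat_vec_def row_def atLeast0LessThan intro!: sum.cong)
  finally show ?thesis .
qed

lemma Re_cscalar_prod_self_pos:
  "(x :: complex vec) \<in> carrier_vec n \<Longrightarrow> x \<noteq> 0\<^sub>v n \<Longrightarrow> Re (x \<bullet>c x) > 0"
  using conjugate_square_greater_0_vec[of x n] by (auto simp: less_complex_def)

section \<open>Quadratic forms, definiteness and inverses\<close>

lemma Re_quadratic_form_add:
  assumes A: "(A :: complex mat) \<in> carrier_mat n n" and B: "B \<in> carrier_mat n n" and x: "x \<in> carrier_vec n"
  shows "Re (((A + B) *\<^sub>v x) \<bullet>c x) = Re ((A *\<^sub>v x) \<bullet>c x) + Re ((B *\<^sub>v x) \<bullet>c x)"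
  using A B x mult_mat_vec_carrier[OF A x] mult_mat_vec_carrier[OF B x]
  by (simp add: add_mult_distrib_mat_vec[OF A B x] cscalar_prod_add_left[of _ n])

lemma Re_quadratic_form_diff:
  assumes A: "(A :: complex mat) \<in> carrier_mat n n" and B: "B \<in> carrier_mat n n" and x: "x \<in> carrier_vec n"
  shows "Re (((A - B) *\<^sub>v x) \<bullet>c x) = Re ((A *\<^sub>v x) \<bullet>c x) - Re ((B *\<^sub>v x) \<bullet>c x)"
  using A B x mult_mat_vec_carrier[OF A x] mult_mat_vec_carrier[OF B x]
  by (simp add: minus_mult_distrib_mat_vec[OF A B x] cscalar_prod_minus_left[of _ n])

lemma Re_quadratic_form_add_smult:
  assumes H: "(H :: complex mat) \<in> carrier_mat n n" and x: "x \<in> carrier_vec n" and y: "y \<in> carrier_vec n"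
  shows "Re ((H *\<^sub>v (x + of_real t \<cdot>\<^sub>v y)) \<bullet>c (x + of_real t \<cdot>\<^sub>v y)) =
    Re ((H *\<^sub>v x) \<bullet>c x) + t * Re ((H *\<^sub>v x) \<bullet>c y + (H *\<^sub>v y) \<bullet>c x) + t\<^sup>2 * Re ((H *\<^sub>v y) \<bullet>c y)"
proof -
  have "H *\<^sub>v (x + of_real t \<cdot>\<^sub>v y) = H *\<^sub>v x + of_real t \<cdot>\<^sub>v (H *\<^sub>v y)"
    using H x y by (simp add: mult_add_distrib_mat_vec[OF H] mult_mat_vec[OF H])
  moreover have "H *\<^sub>v x \<in> carrier_vec n" "H *\<^sub>v y \<in> carrier_vec n" using H x y by auto
  ultimately have "(H *\<^sub>v (x + of_real t \<cdot>\<^sub>v y)) \<bullet>c (x + of_real t \<cdot>\<^sub>v y) =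
      (H *\<^sub>v x) \<bullet>c x + of_real t * ((H *\<^sub>v x) \<bullet>c y + (H *\<^sub>v y) \<bullet>c x) + of_real (t * t) * ((H *\<^sub>v y) \<bullet>c y)"
    using x y by (simp add: cscalar_prod_add_left[of _ n] cscalar_prod_add_right[of _ n]
        cscalar_prod_smult_left[of _ n] cscalar_prod_smult_right[of _ n] algebra_simps)
  then show ?thesis by (simp add: power2_eq_square)
qed

lemma Re_quadratic_form_smult:
  assumes H: "(H :: complex mat) \<in> carrier_mat n n" and x: "x \<in> carrier_vec n"
  shows "Re ((H *\<^sub>v (a \<cdot>\<^sub>v x)) \<bullet>c (a \<cdot>\<^sub>v x)) = (cmod a)\<^sup>2 * Re ((H *\<^sub>v x) \<bullet>c x)"
proof -
  have "(H *\<^sub>v (a \<cdot>\<^sub>v x)) \<bullet>c (a \<cdot>\<^sub>v x) = (a * cnj a) * ((H *\<^sub>v x) \<bullet>c x)"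
    using H x by (simp add: mult_mat_vec[OF H x] cscalar_prod_smult_left[of _ n] cscalar_prod_smult_right[of _ n])
  also have "a * cnj a = of_real ((cmod a)\<^sup>2)" by (metis complex_norm_square)
  finally show ?thesis by simp
qed

lemma Re_quadratic_form_herm_part:
  assumes M: "(M :: complex mat) \<in> carrier_mat n n" and x: "x \<in> carrier_vec n"
  shows "Re (((M + mat_adjoint M) *\<^sub>v x) \<bullet>c x) = 2 * Re ((M *\<^sub>v x) \<bullet>c x)"
proof -
  have "M *\<^sub>v x \<in> carrier_vec n" "mat_adjoint M *\<^sub>v x \<in> carrier_vec n"
    using M x mult_mat_vec_carrier[OF mat_adjoint_carrier[OF M] x] by auto
  then have "((M + mat_adjoint M) *\<^sub>v x) \<bullet>c x = (M *\<^sub>v x) \<bullet>c x + (mat_adjoint M *\<^sub>v x) \<bullet>c x"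
    using M x by (simp add: add_mult_distrib_mat_vec[of _ n n] cscalar_prod_add_left[of _ n])
  also have "(mat_adjoint M *\<^sub>v x) \<bullet>c x = cnj ((M *\<^sub>v x) \<bullet>c x)"
    using M x by (simp add: cscalar_prod_mat_adjoint[of _ n n] cscalar_prod_swap[of x n])
  finally show ?thesis by simp
qed

lemma herm_part_hermitian:
  "(M :: complex mat) \<in> carrier_mat n n \<Longrightarrow> mat_adjoint (M + mat_adjoint M) = M + mat_adjoint M"
  by (simp add: mat_adjoint_add[of _ n n] comm_add_mat[of _ n n])

lemma herm_part_add_skew_herm:
  assumes "M \<in> carrier_mat n n" and "skew_herm_mat n S"
  shows "(M + S) + mat_adjoint (M + S) = M + mat_adjoint M"
proof (rule eq_matI)
  fix i j assume ij: "i < dim_row (M + mat_adjoint M)" "j < dim_col (M + mat_adjoint M)"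
  have S: "S \<in> carrier_mat n n" "mat_adjoint S = - S" using assms(2) unfolding skew_herm_mat_def by auto
  have "cnj (S $$ (j, i)) = - S $$ (i, j)"
    using arg_cong[OF S(2), of "\<lambda>X. X $$ (i, j)"] ij assms(1) S(1) by simp
  with ij assms(1) S(1) show "((M + S) + mat_adjoint (M + S)) $$ (i, j) = (M + mat_adjoint M) $$ (i, j)" by simp
qed (use assms in \<open>auto simp: skew_herm_mat_def\<close>)

lemma pd_mat_iff_Re:
  "pd_mat n M \<longleftrightarrow> M \<in> carrier_mat n n \<and> (\<forall>x \<in> carrier_vec n. x \<noteq> 0\<^sub>v n \<longrightarrow> Re ((M *\<^sub>v x) \<bullet>c x) > 0)"
  unfolding pd_mat_def hpd_mat_def by (auto simp: herm_part_hermitian Re_quadratic_form_herm_part)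

lemma psd_mat_iff_Re:
  "psd_mat n M \<longleftrightarrow> M \<in> carrier_mat n n \<and> (\<forall>x \<in> carrier_vec n. Re ((M *\<^sub>v x) \<bullet>c x) \<ge> 0)"
  unfolding psd_mat_def hpsd_mat_def by (auto simp: herm_part_hermitian Re_quadratic_form_herm_part)

lemma pd_mat_imp_psd_mat:
  assumes "pd_mat n A"
  shows "psd_mat n A"
  unfolding psd_mat_iff_Re
proof (intro conjI ballI)
  show A: "A \<in> carrier_mat n n" using assms unfolding pd_mat_def by auto
  fix x :: "complex vec" assume x: "x \<in> carrier_vec n"
  show "Re ((A *\<^sub>v x) \<bullet>c x) \<ge> 0"
  proof (cases "x = 0\<^sub>v n")
    case True
    then show ?thesis using A by simp
  next
    case False
    then show ?thesis using assms x unfolding pd_mat_iff_Re by (auto intro: less_imp_le)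
  qed
qed

lemma skew_herm_mat_Re_zero:
  assumes "skew_herm_mat n S" and x: "x \<in> carrier_vec n"
  shows "Re ((S *\<^sub>v x) \<bullet>c x) = 0"
proof -
  have S: "S \<in> carrier_mat n n" and "S + mat_adjoint S = 0\<^sub>m n n"
    using assms(1) unfolding skew_herm_mat_def by auto
  moreover have "(0\<^sub>m n n *\<^sub>v x) \<bullet>c x = 0" using x by (simp add: scalar_prod_def)
  ultimately show ?thesis using Re_quadratic_form_herm_part[OF S x] by simp
qed

text \<open>If \<open>H y \<noteq> 0\<close>, moving \<open>y\<close> a little in the direction \<open>-H y\<close> makes the form negative.\<close>
lemma hpsd_mat_isotropic_kernel:
  assumes "hpsd_mat n H" and y: "y \<in> carrier_vec n" and zero: "Re ((H *\<^sub>v y) \<bullet>c y) = 0"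
  shows "H *\<^sub>v y = 0\<^sub>v n"
proof (rule ccontr)
  assume ne: "H *\<^sub>v y \<noteq> 0\<^sub>v n"
  have H: "H \<in> carrier_mat n n" and herm: "mat_adjoint H = H"
    and psd: "\<And>x. x \<in> carrier_vec n \<Longrightarrow> Re ((H *\<^sub>v x) \<bullet>c x) \<ge> 0"
    using assms(1) unfolding hpsd_mat_def by auto
  define w where "w = H *\<^sub>v y"
  have w: "w \<in> carrier_vec n" using H y unfolding w_def by auto
  define a where "a = Re (w \<bullet>c w)"
  define b where "b = Re ((H *\<^sub>v w) \<bullet>c w)"
  have a: "a > 0" unfolding a_def using Re_cscalar_prod_self_pos[OF w] ne by (simp add: w_def)
  have b: "b \<ge> 0" unfolding b_def using psd w by auto
  have "(H *\<^sub>v w) \<bullet>c y = w \<bullet>c w"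
    using cscalar_prod_mat_adjoint[OF H w y] herm by (simp add: w_def)
  then have expand: "Re ((H *\<^sub>v (y + of_real t \<cdot>\<^sub>v w)) \<bullet>c (y + of_real t \<cdot>\<^sub>v w)) = t * (2 * a + t * b)" for t
    using Re_quadratic_form_add_smult[OF H y w, of t] zero
    by (simp add: a_def b_def w_def power2_eq_square algebra_simps)
  define t where "t = - a / (b + 1)"
  have "t < 0" unfolding t_def using a b by (simp add: divide_neg_pos)
  moreover have "- t * b \<le> a" unfolding t_def using a b by (simp add: field_simps)
  then have "0 < 2 * a + t * b" using a by linarith
  ultimately have "t * (2 * a + t * b) < 0" by (rule mult_neg_pos)
  with expand[of t] psd[of "y + of_real t \<cdot>\<^sub>v w"] y w show False by auto
qed

lemma psd_mat_isotropic_kernel: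
  assumes "psd_mat n M" and y: "y \<in> carrier_vec n" and zero: "Re ((M *\<^sub>v y) \<bullet>c y) = 0"
  shows "(M + mat_adjoint M) *\<^sub>v y = 0\<^sub>v n"
  using assms hpsd_mat_isotropic_kernel[of n "M + mat_adjoint M" y] Re_quadratic_form_herm_part[of M n y]
  unfolding psd_mat_def by simp

lemma det_nonzero_if_Re_pos:
  assumes M: "(M :: complex mat) \<in> carrier_mat n n"
    and pos: "\<And>x. x \<in> carrier_vec n \<Longrightarrow> x \<noteq> 0\<^sub>v n \<Longrightarrow> Re ((M *\<^sub>v x) \<bullet>c x) > 0"
  shows "det M \<noteq> 0"
  using pos det_0_iff_vec_prod_zero[OF M] by fastforce

lemma hpd_mat_det_nonzero: "hpd_mat n H \<Longrightarrow> det H \<noteq> 0"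
  using det_nonzero_if_Re_pos[of H n] unfolding hpd_mat_def by auto

lemma
  assumes M: "(M :: complex mat) \<in> carrier_mat n n" and det: "det M \<noteq> 0"
  shows minv_carrier: "minv M \<in> carrier_mat n n"
    and mat_mult_minv: "M * minv M = 1\<^sub>m n"
    and minv_mat_mult: "minv M * M = 1\<^sub>m n"
proof -
  have "M \<in> Units (ring_mat TYPE(complex) n undefined)" by (rule det_non_zero_imp_unit[OF M det])
  then obtain B where B: "mat_inverse M = Some B"
    using mat_inverse(1)[OF M, of undefined] by (cases "mat_inverse M") auto
  from mat_inverse(2)[OF M B] show "minv M \<in> carrier_mat n n" "M * minv M = 1\<^sub>m n" "minv M * M = 1\<^sub>m n"
    unfolding minv_def B by auto
qed

lemma
  assumes M: "(M :: complex mat) \<in> carrier_mat n n" and det: "det M \<noteq> 0" and x: "x \<in> carrier_vec n"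
  shows minv_mult_vec_cancel: "minv M *\<^sub>v (M *\<^sub>v x) = x"
    and mult_vec_minv_cancel: "M *\<^sub>v (minv M *\<^sub>v x) = x"
  using assoc_mult_mat_vec[OF minv_carrier[OF M det] M x, symmetric]
    assoc_mult_mat_vec[OF M minv_carrier[OF M det] x, symmetric]
    minv_mat_mult[OF M det] mat_mult_minv[OF M det] x by auto

lemma mult_mat_vec_inj:
  assumes "(M :: complex mat) \<in> carrier_mat n n" "det M \<noteq> 0" "x \<in> carrier_vec n" "y \<in> carrier_vec n"
    and "M *\<^sub>v x = M *\<^sub>v y"
  shows "x = y"
  by (metis assms minv_mult_vec_cancel)

section \<open>Semi-convergent matrices\<close>

lemma affine_recurrence_tendsto_zero:
  fixes s b :: "nat \<Rightarrow> 'a :: real_normed_div_algebra"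
  assumes c: "norm c < 1" and rec: "\<And>k. s (Suc k) = c * s k + b k" and b: "b \<longlonglongrightarrow> 0"
  shows "s \<longlonglongrightarrow> 0"
proof (rule LIMSEQ_I)
  fix e :: real assume e: "e > 0"
  define r where "r = norm c"
  have r: "0 \<le> r" "r < 1" using c unfolding r_def by auto
  have "e * (1 - r) / 2 > 0" using e r by auto
  from LIMSEQ_D[OF b this] obtain K where K: "\<And>k. k \<ge> K \<Longrightarrow> norm (b k) < e * (1 - r) / 2" by auto
  have bound: "norm (s (K + j)) \<le> r ^ j * norm (s K) + e / 2" for j
  proof (induct j)
    case 0 then show ?case using e by simp
  next
    case (Suc j)
    have "norm (s (K + Suc j)) \<le> r * norm (s (K + j)) + norm (b (K + j))"
      unfolding add_Suc_right rec r_def by (metis norm_mult norm_triangle_ineq)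
    also have "\<dots> \<le> r * (r ^ j * norm (s K) + e / 2) + e * (1 - r) / 2"
      using K[of "K + j"] Suc r by (intro add_mono mult_left_mono) auto
    also have "\<dots> = r ^ Suc j * norm (s K) + e / 2" by (simp add: field_simps)
    finally show ?case .
  qed
  have "(\<lambda>j. r ^ j * norm (s K)) \<longlonglongrightarrow> 0" using r by (intro tendsto_mult_left_zero LIMSEQ_power_zero) auto
  from LIMSEQ_D[OF this, of "e / 2"] e obtain J where J: "\<And>j. j \<ge> J \<Longrightarrow> \<bar>r ^ j * norm (s K)\<bar> < e / 2"
    by auto
  show "\<exists>k0. \<forall>k\<ge>k0. norm (s k - 0) < e"
  proof (intro exI allI impI)
    fix k assume k: "k \<ge> K + J"
    define j where "j = k - K"
    have j: "k = K + j" "j \<ge> J" using k unfolding j_def by auto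
    show "norm (s k - 0) < e" using bound[of j] J[OF j(2)] unfolding j(1) by auto
  qed
qed

lemma prod_list_map_split_value:
  fixes f :: "'a \<Rightarrow> 'b :: comm_monoid_mult"
  shows "(\<Prod>a\<leftarrow>as. f a) = f c ^ length (filter ((=) c) as) * (\<Prod>a\<leftarrow>filter ((\<noteq>) c) as. f a)"
  by (induct as) (auto simp: mult_ac)

text \<open>Horner evaluation of \<open>p(G) x\<close>.\<close>
definition poly_mat_vec :: "complex mat \<Rightarrow> complex poly \<Rightarrow> complex vec \<Rightarrow> complex vec" where
  "poly_mat_vec G p x = foldr (\<lambda>a y. a \<cdot>\<^sub>v x + G *\<^sub>v y) (coeffs p) (0\<^sub>v (dim_row G))"

context
  fixes G :: "complex mat" and N :: nat
  assumes G: "G \<in> carrier_mat N N"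
begin

lemma poly_mat_vec_0 [simp]: "poly_mat_vec G 0 x = 0\<^sub>v N"
  unfolding poly_mat_vec_def using G by auto

lemma poly_mat_vec_pCons:
  assumes x: "x \<in> carrier_vec N"
  shows "poly_mat_vec G (pCons a p) x = a \<cdot>\<^sub>v x + G *\<^sub>v poly_mat_vec G p x"
proof (cases "a = 0 \<and> p = 0")
  case True
  then show ?thesis using G x by (intro eq_vecI) auto
next
  case False
  then have "coeffs (pCons a p) = a # coeffs p" by (auto simp: cCons_def)
  then show ?thesis unfolding poly_mat_vec_def by simp
qed

lemma poly_mat_vec_carrier [simp]: "x \<in> carrier_vec N \<Longrightarrow> poly_mat_vec G p x \<in> carrier_vec N"
  by (induct p rule: pCons_induct) (use G in \<open>auto simp: poly_mat_vec_pCons\<close>)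

lemma poly_mat_vec_1 [simp]: "x \<in> carrier_vec N \<Longrightarrow> poly_mat_vec G 1 x = x"
  using G poly_mat_vec_pCons[of x 1 0] by (simp add: one_pCons)

lemma poly_mat_vec_add:
  assumes x: "x \<in> carrier_vec N"
  shows "poly_mat_vec G (p + q) x = poly_mat_vec G p x + poly_mat_vec G q x"
proof (induct p arbitrary: q rule: pCons_induct)
  case 0 then show ?case using x by auto
next
  case (pCons a p)
  obtain b q' where q: "q = pCons b q'" by (cases q) auto
  show ?case unfolding q add_pCons poly_mat_vec_pCons[OF x] pCons(2)
    using G x by (subst mult_add_distrib_mat_vec[OF G]) (auto intro!: eq_vecI simp: algebra_simps)
qed

lemma poly_mat_vec_smult:
  assumes x: "x \<in> carrier_vec N"
  shows "poly_mat_vec G (Polynomial.smult c p) x = c \<cdot>\<^sub>v poly_mat_vec G p x"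
proof (induct p rule: pCons_induct)
  case 0 then show ?case using x by auto
next
  case (pCons a p)
  show ?case unfolding smult_pCons poly_mat_vec_pCons[OF x] pCons(2)
    using G x by (subst mult_mat_vec[OF G]) (auto intro!: eq_vecI simp: algebra_simps)
qed

lemma poly_mat_vec_vec_diff:
  assumes x: "x \<in> carrier_vec N" and y: "y \<in> carrier_vec N"
  shows "poly_mat_vec G p (x - y) = poly_mat_vec G p x - poly_mat_vec G p y"
proof (induct p rule: pCons_induct)
  case 0 then show ?case using x by auto
next
  case (pCons a p)
  have "x - y \<in> carrier_vec N" using x y by simp
  then show ?case unfolding poly_mat_vec_pCons[OF x] poly_mat_vec_pCons[OF y] poly_mat_vec_pCons[OF \<open>x - y \<in> _\<close>] pCons(2)
    using G x y by (subst mult_minus_distrib_mat_vec[OF G]) (auto intro!: eq_vecI simp: algebra_simps)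
qed

lemma poly_mat_vec_mult:
  assumes x: "x \<in> carrier_vec N"
  shows "poly_mat_vec G (p * q) x = poly_mat_vec G p (poly_mat_vec G q x)"
proof (induct p rule: pCons_induct)
  case 0 then show ?case using x by auto
next
  case (pCons a p)
  have qx: "poly_mat_vec G q x \<in> carrier_vec N" using x by simp
  have "poly_mat_vec G (pCons a p * q) x = poly_mat_vec G (Polynomial.smult a q + pCons 0 (p * q)) x"
    by simp
  also have "\<dots> = a \<cdot>\<^sub>v poly_mat_vec G q x + G *\<^sub>v poly_mat_vec G p (poly_mat_vec G q x)"
    unfolding poly_mat_vec_add[OF x] poly_mat_vec_smult[OF x] poly_mat_vec_pCons[OF x] pCons(2)
    using G x qx by (intro eq_vecI) auto
  also have "\<dots> = poly_mat_vec G (pCons a p) (poly_mat_vec G q x)"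
    unfolding poly_mat_vec_pCons[OF qx] ..
  finally show ?case .
qed

lemma poly_mat_vec_linear:
  "x \<in> carrier_vec N \<Longrightarrow> poly_mat_vec G [:- a, 1:] x = G *\<^sub>v x - a \<cdot>\<^sub>v x"
  using G by (intro eq_vecI) (auto simp: poly_mat_vec_pCons)

lemma poly_mat_vec_fixed_point:
  assumes x: "x \<in> carrier_vec N" and fixed: "G *\<^sub>v x = x"
  shows "poly_mat_vec G p x = poly p 1 \<cdot>\<^sub>v x"
proof (induct p rule: pCons_induct)
  case 0 then show ?case using x by auto
next
  case (pCons a p)
  show ?case unfolding poly_mat_vec_pCons[OF x] pCons(2) mult_mat_vec[OF G x] fixed
    using x by (intro eq_vecI) (auto simp: algebra_simps)
qed

lemma poly_mat_vec_prod_Cons: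
  assumes x: "x \<in> carrier_vec N"
  shows "poly_mat_vec G (\<Prod>c\<leftarrow>a # cs. [:- c, 1:]) x = poly_mat_vec G (\<Prod>c\<leftarrow>cs. [:- c, 1:]) (G *\<^sub>v x - a \<cdot>\<^sub>v x)"
proof -
  have "(\<Prod>c\<leftarrow>a # cs. [:- c, 1:]) = (\<Prod>c\<leftarrow>cs. [:- c, 1:]) * [:- a, 1:]" by (simp add: mult.commute)
  then show ?thesis by (simp only: poly_mat_vec_mult[OF x] poly_mat_vec_linear[OF x])
qed

lemma mat_vec_iterate_carrier [simp]: "x \<in> carrier_vec N \<Longrightarrow> ((*\<^sub>v) G ^^ k) x \<in> carrier_vec N"
  by (induct k) (use G in auto)

lemma mat_vec_iterate_dim [simp]: "x \<in> carrier_vec N \<Longrightarrow> dim_vec (((*\<^sub>v) G ^^ k) x) = N"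
  by (rule carrier_vecD[OF mat_vec_iterate_carrier])

lemma mat_vec_iterate_Suc': "((*\<^sub>v) G ^^ Suc k) x = ((*\<^sub>v) G ^^ k) (G *\<^sub>v x)"
  by (simp add: funpow_Suc_right del: funpow.simps)

lemma mat_vec_iterate_add:
  "x \<in> carrier_vec N \<Longrightarrow> y \<in> carrier_vec N \<Longrightarrow> ((*\<^sub>v) G ^^ k) (x + y) = ((*\<^sub>v) G ^^ k) x + ((*\<^sub>v) G ^^ k) y"
  by (induct k) (use G in \<open>auto simp: mult_add_distrib_mat_vec[OF G]\<close>)

lemma mat_vec_iterate_smult:
  "x \<in> carrier_vec N \<Longrightarrow> ((*\<^sub>v) G ^^ k) (c \<cdot>\<^sub>v x) = c \<cdot>\<^sub>v ((*\<^sub>v) G ^^ k) x"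
  by (induct k) (use G in \<open>auto simp: mult_mat_vec[OF G]\<close>)

lemma mat_vec_iterate_fixed_point: "G *\<^sub>v x = x \<Longrightarrow> ((*\<^sub>v) G ^^ k) x = x"
  by (induct k) auto

lemma poly_mat_vec_eq_sum:
  assumes x: "x \<in> carrier_vec N"
  shows "(\<forall>j\<ge>d. coeff p j = 0) \<Longrightarrow> i < N \<Longrightarrow>
    poly_mat_vec G p x $ i = (\<Sum>j<d. coeff p j * ((*\<^sub>v) G ^^ j) x $ i)"
proof (induct p arbitrary: d i rule: pCons_induct)
  case 0 then show ?case by simp
next
  case (pCons a p)
  obtain d' where d: "d = Suc d'"
  proof (cases d)
    case 0
    with pCons(3) have z: "coeff (pCons a p) j = 0" for j by auto
    have "a = 0" using z[of 0] by simp
    moreover have "p = 0" by (rule poly_eqI) (use z[of "Suc _"] in simp)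
    ultimately show ?thesis using pCons(1) by simp
  qed
  have cp: "\<forall>j\<ge>d'. coeff p j = 0" using pCons(3) d by (auto simp: coeff_pCons split: nat.splits)
  have "poly_mat_vec G (pCons a p) x $ i = a * x $ i + row G i \<bullet> poly_mat_vec G p x"
    using pCons(4) G x by (simp add: poly_mat_vec_pCons[OF x])
  also have "row G i \<bullet> poly_mat_vec G p x = (\<Sum>k<N. G $$ (i,k) * (\<Sum>j<d'. coeff p j * ((*\<^sub>v) G ^^ j) x $ k))"
    using G x pCons(4) pCons(2)[OF cp] by (auto simp: scalar_prod_def atLeast0LessThan intro!: sum.cong)
  also have "\<dots> = (\<Sum>j<d'. coeff p j * ((*\<^sub>v) G ^^ Suc j) x $ i)"
    using G x pCons(4)
    by (simp add: scalar_prod_def atLeast0LessThan sum_distrib_left sum_distrib_right mult_ac, subst sum.swap,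
        auto simp: carrier_vecD[OF mat_vec_iterate_carrier[OF x]] intro!: sum.cong)
  also have "a * x $ i + \<dots> = (\<Sum>j<d. coeff (pCons a p) j * ((*\<^sub>v) G ^^ j) x $ i)"
    unfolding d sum.lessThan_Suc_shift by simp
  finally show ?case .
qed

text \<open>The \<open>N + 1\<close> Krylov vectors \<open>G\<^sup>j x\<close>, \<open>j \<le> N\<close>, are linearly dependent: they are the
  columns of a square matrix whose last row is zero.\<close>
lemma annihilating_poly_exists:
  assumes x: "x \<in> carrier_vec N"
  shows "\<exists>p. p \<noteq> 0 \<and> poly_mat_vec G p x = 0\<^sub>v N"
proof -
  define K where "K = mat\<^sub>r (Suc N) (Suc N)
    (\<lambda>i. if i = N then 0\<^sub>v (Suc N) else vec (Suc N) (\<lambda>j. ((*\<^sub>v) G ^^ j) x $ i))"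
  have K: "K \<in> carrier_mat (Suc N) (Suc N)" unfolding K_def by auto
  have "det K = 0" unfolding K_def by (rule det_row_0) auto
  then obtain v where v: "v \<in> carrier_vec (Suc N)" "v \<noteq> 0\<^sub>v (Suc N)" "K *\<^sub>v v = 0\<^sub>v (Suc N)"
    using det_0_iff_vec_prod_zero[OF K] by auto
  define p where "p = Poly (list_of_vec v)"
  have coeff_p: "coeff p j = (if j < Suc N then v $ j else 0)" for j
    unfolding p_def using v(1) by (auto simp: nth_default_def)
  have "p \<noteq> 0"
  proof
    assume "p = 0"
    then have "v $ j = 0" if "j < Suc N" for j using coeff_p[of j] that by auto
    then have "v = 0\<^sub>v (Suc N)" using v(1) by (intro eq_vecI) auto
    with v(2) show False ..
  qed
  moreover have "poly_mat_vec G p x = 0\<^sub>v N"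
  proof (rule eq_vecI)
    fix i assume "i < dim_vec (0\<^sub>v N :: complex vec)"
    then have i: "i < N" by simp
    have "poly_mat_vec G p x $ i = (\<Sum>j<Suc N. coeff p j * ((*\<^sub>v) G ^^ j) x $ i)"
      by (rule poly_mat_vec_eq_sum[OF x _ i]) (auto simp: coeff_p)
    also have "\<dots> = (K *\<^sub>v v) $ i"
      using i v(1) by (auto simp: K_def coeff_p scalar_prod_def atLeast0LessThan mult.commute intro!: sum.cong)
    finally show "poly_mat_vec G p x $ i = 0\<^sub>v N $ i" using v(3) i by simp
  qed (use x in auto)
  ultimately show ?thesis by blast
qed

lemma poly_mat_vec_filter_eigenvalues:
  "x \<in> carrier_vec N \<Longrightarrow> poly_mat_vec G (\<Prod>c\<leftarrow>as. [:- c, 1:]) x = 0\<^sub>v N \<Longrightarrow>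
    poly_mat_vec G (\<Prod>c\<leftarrow>filter (eigenvalue G) as. [:- c, 1:]) x = 0\<^sub>v N"
proof (induct as arbitrary: x)
  case Nil then show ?case by simp
next
  case (Cons a as)
  show ?case
  proof (cases "eigenvalue G a")
    case True
    have "G *\<^sub>v x - a \<cdot>\<^sub>v x \<in> carrier_vec N" using G Cons(2) by auto
    from Cons(1)[OF this Cons(3)[unfolded poly_mat_vec_prod_Cons[OF Cons(2)]]] show ?thesis
      using True by (simp only: filter.simps if_True poly_mat_vec_prod_Cons[OF Cons(2)])
  next
    case False
    define w where "w = poly_mat_vec G (\<Prod>c\<leftarrow>as. [:- c, 1:]) x"
    have w: "w \<in> carrier_vec N" unfolding w_def using Cons(2) by simp
    have "poly_mat_vec G [:- a, 1:] w = 0\<^sub>v N"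
      using Cons(3) poly_mat_vec_mult[OF Cons(2), of "[:- a, 1:]"] by (simp add: w_def)
    then have "G *\<^sub>v w = a \<cdot>\<^sub>v w"
      using G w by (auto simp: poly_mat_vec_linear[OF w] vec_eq_iff)
    then have "w = 0\<^sub>v N"
      using False G w unfolding eigenvalue_def eigenvector_def by auto
    then show ?thesis using Cons(1)[OF Cons(2)] False by (simp add: w_def)
  qed
qed

lemma annihilating_poly_eigenvalue_roots:
  assumes x: "x \<in> carrier_vec N"
  obtains as where "\<forall>a \<in> set as. eigenvalue G a" and "poly_mat_vec G (\<Prod>a\<leftarrow>as. [:- a, 1:]) x = 0\<^sub>v N"
proof -
  obtain p where p: "p \<noteq> 0" "poly_mat_vec G p x = 0\<^sub>v N" using annihilating_poly_exists[OF x] by blast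
  obtain as where as: "Polynomial.smult (lead_coeff p) (\<Prod>a\<leftarrow>as. [:- a, 1:]) = p"
    using fundamental_theorem_algebra_factorized[of p] by blast
  define w where "w = poly_mat_vec G (\<Prod>a\<leftarrow>as. [:- a, 1:]) x"
  have "lead_coeff p \<cdot>\<^sub>v w = 0\<^sub>v N"
    unfolding w_def p(2)[symmetric] by (subst (2) as[symmetric]) (rule poly_mat_vec_smult[OF x, symmetric])
  then have "(1 / lead_coeff p) \<cdot>\<^sub>v (lead_coeff p \<cdot>\<^sub>v w) = 0\<^sub>v N" by (intro eq_vecI) auto
  then have "w = 0\<^sub>v N" using p(1) by (simp add: smult_smult_assoc)
  then have "poly_mat_vec G (\<Prod>a\<leftarrow>filter (eigenvalue G) as. [:- a, 1:]) x = 0\<^sub>v N"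
    unfolding w_def by (rule poly_mat_vec_filter_eigenvalues[OF x])
  moreover have "\<forall>a \<in> set (filter (eigenvalue G) as). eigenvalue G a" by simp
  ultimately show ?thesis using that by blast
qed

lemma mat_vec_iterate_tendsto_zero:
  assumes "\<forall>c \<in> set cs. cmod c < 1"
  shows "y \<in> carrier_vec N \<Longrightarrow> poly_mat_vec G (\<Prod>c\<leftarrow>cs. [:- c, 1:]) y = 0\<^sub>v N \<Longrightarrow> i < N \<Longrightarrow>
    (\<lambda>k. ((*\<^sub>v) G ^^ k) y $ i) \<longlonglongrightarrow> 0"
  using assms
proof (induct cs arbitrary: y)
  case Nil
  then show ?case using G by (simp add: mat_vec_iterate_fixed_point)
next
  case (Cons c cs)
  define v where "v = G *\<^sub>v y - c \<cdot>\<^sub>v y"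
  have v: "v \<in> carrier_vec N" unfolding v_def using G Cons(2) by auto
  have "poly_mat_vec G (\<Prod>c\<leftarrow>cs. [:- c, 1:]) v = 0\<^sub>v N"
    using Cons(3) unfolding poly_mat_vec_prod_Cons[OF Cons(2)] v_def .
  with Cons(1)[OF v _ Cons(4)] Cons(5) have decay: "(\<lambda>k. ((*\<^sub>v) G ^^ k) v $ i) \<longlonglongrightarrow> 0" by simp
  have step: "((*\<^sub>v) G ^^ Suc k) y $ i = c * ((*\<^sub>v) G ^^ k) y $ i + ((*\<^sub>v) G ^^ k) v $ i" for k
  proof -
    have "G *\<^sub>v y = c \<cdot>\<^sub>v y + v" unfolding v_def using G Cons(2) by (intro eq_vecI) auto
    then have "((*\<^sub>v) G ^^ Suc k) y = ((*\<^sub>v) G ^^ k) (c \<cdot>\<^sub>v y + v)"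
      unfolding mat_vec_iterate_Suc' by simp
    also have "\<dots> = c \<cdot>\<^sub>v ((*\<^sub>v) G ^^ k) y + ((*\<^sub>v) G ^^ k) v"
      using Cons(2) v by (simp add: mat_vec_iterate_add mat_vec_iterate_smult)
    finally have "((*\<^sub>v) G ^^ Suc k) y = c \<cdot>\<^sub>v ((*\<^sub>v) G ^^ k) y + ((*\<^sub>v) G ^^ k) v" .
    then show ?thesis using Cons(2,4) v by simp
  qed
  show ?case by (rule affine_recurrence_tendsto_zero[OF _ step decay]) (use Cons(5) in simp)
qed

lemma fixed_point_if_unipotent_annihilated:
  assumes index1: "\<And>w. w \<in> carrier_vec N \<Longrightarrow> G *\<^sub>v (G *\<^sub>v w - w) = G *\<^sub>v w - w \<Longrightarrow> G *\<^sub>v w = w"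
  shows "w \<in> carrier_vec N \<Longrightarrow> poly_mat_vec G ([:- 1, 1:] ^ r) w = 0\<^sub>v N \<Longrightarrow> G *\<^sub>v w = w"
proof (induct r arbitrary: w)
  case 0
  then show ?case using G by simp
next
  case (Suc r)
  have "G *\<^sub>v w - w \<in> carrier_vec N" using G Suc(2) by auto
  moreover have "poly_mat_vec G ([:- 1, 1:] ^ r) (G *\<^sub>v w - 1 \<cdot>\<^sub>v w) = 0\<^sub>v N"
    using Suc(3) unfolding power_Suc2 poly_mat_vec_mult[OF Suc(2)] poly_mat_vec_linear[OF Suc(2)] .
  then have "poly_mat_vec G ([:- 1, 1:] ^ r) (G *\<^sub>v w - w) = 0\<^sub>v N"
    by (simp only: one_smult_vec)
  ultimately show ?case using Suc(1) index1 Suc(2) by blast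
qed

end

text \<open>Split an annihilating polynomial of \<open>x\<close> as \<open>(X - 1)\<^sup>r Q\<close> with the roots of \<open>Q\<close> inside the unit
  disc.  Then \<open>Q(G) x\<close> is fixed by \<open>G\<close>, and \<open>x\<close> minus the right multiple of it is annihilated by \<open>Q\<close>, so
  its iterates tend to zero.\<close>
theorem mat_vec_iterate_converges:
  assumes G: "G \<in> carrier_mat N N"
    and spectrum: "\<And>a. eigenvalue G a \<Longrightarrow> cmod a < 1 \<or> a = 1"
    and index1: "\<And>w. w \<in> carrier_vec N \<Longrightarrow> G *\<^sub>v (G *\<^sub>v w - w) = G *\<^sub>v w - w \<Longrightarrow> G *\<^sub>v w = w"
    and x: "x \<in> carrier_vec N"
  shows "\<exists>L \<in> carrier_vec N. G *\<^sub>v L = L \<and> (\<forall>i < N. (\<lambda>k. ((*\<^sub>v) G ^^ k) x $ i) \<longlonglongrightarrow> L $ i)"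
proof -
  obtain as where eig: "\<forall>a \<in> set as. eigenvalue G a"
    and ann: "poly_mat_vec G (\<Prod>a\<leftarrow>as. [:- a, 1:]) x = 0\<^sub>v N"
    using annihilating_poly_eigenvalue_roots[OF G x] by blast
  define cs where "cs = filter ((\<noteq>) 1) as"
  define Q where "Q = (\<Prod>c\<leftarrow>cs. [:- c, 1:])"
  have cs: "\<forall>c \<in> set cs. cmod c < 1" using eig spectrum unfolding cs_def by auto
  then have Q1: "poly Q 1 \<noteq> 0" unfolding Q_def poly_prod_list by auto
  define z where "z = poly_mat_vec G Q x"
  have z: "z \<in> carrier_vec N" unfolding z_def using G x by simp
  have "poly_mat_vec G ([:- 1, 1:] ^ length (filter ((=) 1) as) * Q) x = 0\<^sub>v N"
    using ann unfolding prod_list_map_split_value[of _ as 1] Q_def cs_def .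
  then have "poly_mat_vec G ([:- 1, 1:] ^ length (filter ((=) 1) as)) z = 0\<^sub>v N"
    unfolding poly_mat_vec_mult[OF G x] z_def .
  then have Gz: "G *\<^sub>v z = z" using fixed_point_if_unipotent_annihilated[OF G index1 z] by blast
  define L where "L = (1 / poly Q 1) \<cdot>\<^sub>v z"
  have L: "L \<in> carrier_vec N" and GL: "G *\<^sub>v L = L"
    unfolding L_def using z Gz mult_mat_vec[OF G z] by auto
  define y where "y = x - L"
  have y: "y \<in> carrier_vec N" unfolding y_def using x L by simp
  have "poly_mat_vec G Q L = z"
    using poly_mat_vec_fixed_point[OF G L GL] Q1 z unfolding L_def by (intro eq_vecI) auto
  then have "poly_mat_vec G Q y = z - z"
    unfolding y_def poly_mat_vec_vec_diff[OF G x L] z_def by simp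
  also have "\<dots> = 0\<^sub>v N" using z by (intro eq_vecI) auto
  finally have decay: "(\<lambda>k. ((*\<^sub>v) G ^^ k) y $ i) \<longlonglongrightarrow> 0" if "i < N" for i
    using mat_vec_iterate_tendsto_zero[OF G cs y] that unfolding Q_def by blast
  have "((*\<^sub>v) G ^^ k) x $ i = L $ i + ((*\<^sub>v) G ^^ k) y $ i" if "i < N" for i k
  proof -
    have "x = L + y" unfolding y_def using x L by (intro eq_vecI) auto
    then show ?thesis
      using that L y by (simp add: mat_vec_iterate_add[OF G L y] mat_vec_iterate_fixed_point[OF G GL] mat_vec_iterate_dim[OF G y])
  qed
  with decay have "(\<lambda>k. ((*\<^sub>v) G ^^ k) x $ i) \<longlonglongrightarrow> L $ i" if "i < N" for i
    using that tendsto_add[OF tendsto_const[of "L $ i"] decay[OF that]] by simp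
  with L GL show ?thesis by blast
qed

section \<open>Splitting iterations that decrease an energy\<close>

declare minus_carrier_mat [simp]

lemma mult_mat_vec_carrier_square [simp]:
  "A \<in> carrier_mat n n \<Longrightarrow> v \<in> carrier_vec n \<Longrightarrow> A *\<^sub>v v \<in> carrier_vec n"
  by simp

lemma mult_carrier_mat_square [simp]:
  "A \<in> carrier_mat n n \<Longrightarrow> B \<in> carrier_mat n n \<Longrightarrow> A * B \<in> carrier_mat n n"
  by simp

lemma quadratic_unbounded_nat:
  fixes K e :: real
  assumes "e > 0"
  obtains k :: nat where "k * K + (real k)\<^sup>2 * e > 0"
proof
  define k where "k = nat \<lceil>\<bar>K\<bar> / e\<rceil> + 1"
  have "\<bar>K\<bar> / e < real k" unfolding k_def by linarith
  then have "\<bar>K\<bar> < real k * e" using assms by (simp add: field_simps)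
  then have "0 < real k * (K + real k * e)" unfolding k_def by (intro mult_pos_pos) auto
  then show "k * K + (real k)\<^sup>2 * e > 0" by (simp add: power2_eq_square algebra_simps)
qed

locale splitting_iteration =
  fixes N :: nat and \<Sigma> P S :: "complex mat"
  assumes Sigma: "hpd_mat N \<Sigma>" and P: "psd_mat N P" and S: "skew_herm_mat N S"
begin

lemma carrier_mats [simp]: "\<Sigma> \<in> carrier_mat N N" "P \<in> carrier_mat N N" "S \<in> carrier_mat N N"
  using Sigma P S unfolding hpd_mat_def psd_mat_def skew_herm_mat_def by auto

lemma Sigma_hermitian: "mat_adjoint \<Sigma> = \<Sigma>"
  using Sigma unfolding hpd_mat_def by auto

lemma Re_Sigma_pos: "x \<in> carrier_vec N \<Longrightarrow> x \<noteq> 0\<^sub>v N \<Longrightarrow> Re ((\<Sigma> *\<^sub>v x) \<bullet>c x) > 0"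
  using Sigma unfolding hpd_mat_def by auto

lemma Re_P_nonneg: "x \<in> carrier_vec N \<Longrightarrow> Re ((P *\<^sub>v x) \<bullet>c x) \<ge> 0"
  using P unfolding psd_mat_iff_Re by auto

lemma Re_S_zero: "x \<in> carrier_vec N \<Longrightarrow> Re ((S *\<^sub>v x) \<bullet>c x) = 0"
  using skew_herm_mat_Re_zero[OF S] .

lemma det_nonzero: "det \<Sigma> \<noteq> 0" "det (\<Sigma> + P) \<noteq> 0" "det (\<Sigma> + S) \<noteq> 0" "det (\<Sigma> - S) \<noteq> 0"
  by (rule det_nonzero_if_Re_pos[of _ N];
      simp add: Re_quadratic_form_add[of _ N] Re_quadratic_form_diff[of _ N] Re_Sigma_pos Re_S_zero
        add_pos_nonneg Re_P_nonneg)+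

definition iteration_matrix :: "complex mat" where
  "iteration_matrix = minv (\<Sigma> + S) * (\<Sigma> - P) * minv (\<Sigma> + P) * (\<Sigma> - S)"

definition iteration_vector :: "complex vec \<Rightarrow> complex vec" where
  "iteration_vector b = (2 \<cdot>\<^sub>m (minv (\<Sigma> + S) * \<Sigma> * minv (\<Sigma> + P))) *\<^sub>v b"

definition half_step :: "complex vec \<Rightarrow> complex vec" where
  "half_step u = minv (\<Sigma> + P) *\<^sub>v ((\<Sigma> - S) *\<^sub>v u)"

lemma minv_carriers [simp]:
  "minv \<Sigma> \<in> carrier_mat N N" "minv (\<Sigma> + P) \<in> carrier_mat N N" "minv (\<Sigma> + S) \<in> carrier_mat N N"
  using minv_carrier det_nonzero by simp_all

lemma iteration_matrix_carrier [simp]: "iteration_matrix \<in> carrier_mat N N"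
  unfolding iteration_matrix_def by simp

lemma dim_rows [simp]: "dim_row \<Sigma> = N" "dim_row P = N" "dim_row S = N" "dim_row iteration_matrix = N"
  using carrier_matD(1)[OF carrier_mats(1)] carrier_matD(1)[OF carrier_mats(2)]
    carrier_matD(1)[OF carrier_mats(3)] carrier_matD(1)[OF iteration_matrix_carrier] by simp_all

lemma iteration_vector_carrier [simp]: "b \<in> carrier_vec N \<Longrightarrow> iteration_vector b \<in> carrier_vec N"
  unfolding iteration_vector_def by simp

lemma iteration_vector_dim [simp]: "b \<in> carrier_vec N \<Longrightarrow> dim_vec (iteration_vector b) = N"
  using iteration_vector_carrier by (rule carrier_vecD)

lemma iteration_vector_zero [simp]: "iteration_vector (0\<^sub>v N) = 0\<^sub>v N"
  unfolding iteration_vector_def by (intro eq_vecI) auto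

lemma half_step_carrier [simp]: "u \<in> carrier_vec N \<Longrightarrow> half_step u \<in> carrier_vec N"
  unfolding half_step_def by simp

lemma half_step_eq: "u \<in> carrier_vec N \<Longrightarrow> (\<Sigma> + P) *\<^sub>v half_step u = (\<Sigma> - S) *\<^sub>v u"
  unfolding half_step_def by (simp add: mult_vec_minv_cancel[of _ N] det_nonzero)

lemma iteration_matrix_eq:
  assumes u: "u \<in> carrier_vec N"
  shows "(\<Sigma> + S) *\<^sub>v (iteration_matrix *\<^sub>v u) = (\<Sigma> - P) *\<^sub>v half_step u"
proof -
  have "iteration_matrix *\<^sub>v u = minv (\<Sigma> + S) *\<^sub>v ((\<Sigma> - P) *\<^sub>v half_step u)"
    unfolding iteration_matrix_def half_step_def using u by (simp add: assoc_mult_mat_vec[of _ N N _ N])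
  then show ?thesis using u by (simp add: mult_vec_minv_cancel[of _ N] det_nonzero)
qed

lemma half_step_nonzero:
  assumes u: "u \<in> carrier_vec N" "u \<noteq> 0\<^sub>v N"
  shows "half_step u \<noteq> 0\<^sub>v N"
proof
  assume h: "half_step u = 0\<^sub>v N"
  have "(\<Sigma> - S) *\<^sub>v u = (\<Sigma> + P) *\<^sub>v half_step u" by (rule half_step_eq[OF u(1), symmetric])
  also have "\<dots> = (\<Sigma> - S) *\<^sub>v 0\<^sub>v N" unfolding h by simp
  finally show False using mult_mat_vec_inj[of "\<Sigma> - S" N u "0\<^sub>v N"] det_nonzero u by simp
qed

lemma cscalar_prod_Sigma_swap:
  "x \<in> carrier_vec N \<Longrightarrow> y \<in> carrier_vec N \<Longrightarrow> x \<bullet>c (\<Sigma> *\<^sub>v y) = (\<Sigma> *\<^sub>v x) \<bullet>c y"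
  using cscalar_prod_mat_adjoint[of \<Sigma> N N x y] Sigma_hermitian by simp

definition Sigma_inv_form :: "complex vec \<Rightarrow> real" where
  "Sigma_inv_form y = Re ((minv \<Sigma> *\<^sub>v y) \<bullet>c y)"

definition energy :: "complex vec \<Rightarrow> real" where
  "energy u = Sigma_inv_form ((\<Sigma> + S) *\<^sub>v u)"

lemma Sigma_inv_form_pos:
  assumes y: "y \<in> carrier_vec N" "y \<noteq> 0\<^sub>v N"
  shows "Sigma_inv_form y > 0"
proof -
  define z where "z = minv \<Sigma> *\<^sub>v y"
  have z: "z \<in> carrier_vec N" and yz: "y = \<Sigma> *\<^sub>v z"
    unfolding z_def using y by (simp_all add: mult_vec_minv_cancel[of _ N] det_nonzero)
  then have "z \<noteq> 0\<^sub>v N" using y by auto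
  moreover have "Sigma_inv_form y = Re ((\<Sigma> *\<^sub>v z) \<bullet>c z)"
    unfolding Sigma_inv_form_def z_def[symmetric] yz using cscalar_prod_swap[of z N "\<Sigma> *\<^sub>v z"] z
    by (simp add: minv_mult_vec_cancel[of _ N] det_nonzero)
  ultimately show ?thesis using Re_Sigma_pos z by simp
qed

lemma Sigma_inv_form_smult: "y \<in> carrier_vec N \<Longrightarrow> Sigma_inv_form (a \<cdot>\<^sub>v y) = (cmod a)\<^sup>2 * Sigma_inv_form y"
  unfolding Sigma_inv_form_def by (rule Re_quadratic_form_smult) simp_all

text \<open>The identity behind the contraction; it is applied with \<open>X = P\<close> and with \<open>X = S\<close>.\<close>
lemma Sigma_inv_form_diff:
  assumes X: "X \<in> carrier_mat N N" and v: "v \<in> carrier_vec N"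
  shows "Sigma_inv_form ((\<Sigma> - X) *\<^sub>v v) = Sigma_inv_form ((\<Sigma> + X) *\<^sub>v v) - 4 * Re ((X *\<^sub>v v) \<bullet>c v)"
proof -
  define a where "a = \<Sigma> *\<^sub>v v"
  define b where "b = X *\<^sub>v v"
  have a: "a \<in> carrier_vec N" and b: "b \<in> carrier_vec N" and Sib: "minv \<Sigma> *\<^sub>v b \<in> carrier_vec N"
    unfolding a_def b_def using X v by auto
  have Sia: "minv \<Sigma> *\<^sub>v a = v" unfolding a_def using v by (simp add: minv_mult_vec_cancel[of _ N] det_nonzero)
  have swap: "(minv \<Sigma> *\<^sub>v b) \<bullet>c a = b \<bullet>c v"
    unfolding a_def using cscalar_prod_Sigma_swap[OF Sib v] b
    by (simp add: mult_vec_minv_cancel[of _ N] det_nonzero)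
  have "(\<Sigma> - X) *\<^sub>v v = a - b" "(\<Sigma> + X) *\<^sub>v v = a + b"
    unfolding a_def b_def using X v by (simp_all add: minus_mult_distrib_mat_vec[of _ N N] add_mult_distrib_mat_vec[of _ N N])
  moreover have "(minv \<Sigma> *\<^sub>v (a - b)) \<bullet>c (a - b) = v \<bullet>c a - v \<bullet>c b - b \<bullet>c v + (minv \<Sigma> *\<^sub>v b) \<bullet>c b"
    using a b v Sib by (simp add: mult_minus_distrib_mat_vec[of _ N N] Sia swap
        cscalar_prod_minus_left[of _ N] cscalar_prod_minus_right[of _ N])
  moreover have "(minv \<Sigma> *\<^sub>v (a + b)) \<bullet>c (a + b) = v \<bullet>c a + v \<bullet>c b + b \<bullet>c v + (minv \<Sigma> *\<^sub>v b) \<bullet>c b"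
    using a b v Sib by (simp add: mult_add_distrib_mat_vec[of _ N N] Sia swap
        cscalar_prod_add_left[of _ N] cscalar_prod_add_right[of _ N])
  moreover have "v \<bullet>c b = cnj (b \<bullet>c v)" by (rule cscalar_prod_swap[OF v b])
  ultimately show ?thesis unfolding Sigma_inv_form_def b_def by simp
qed

lemma energy_pos: "u \<in> carrier_vec N \<Longrightarrow> u \<noteq> 0\<^sub>v N \<Longrightarrow> energy u > 0"
  unfolding energy_def using mult_mat_vec_inj[of "\<Sigma> + S" N u "0\<^sub>v N"] det_nonzero
  by (intro Sigma_inv_form_pos) auto

lemma energy_iteration_matrix:
  assumes u: "u \<in> carrier_vec N"
  shows "energy (iteration_matrix *\<^sub>v u) = energy u - 4 * Re ((P *\<^sub>v half_step u) \<bullet>c half_step u)"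
proof -
  have "energy (iteration_matrix *\<^sub>v u) = Sigma_inv_form ((\<Sigma> - P) *\<^sub>v half_step u)"
    unfolding energy_def iteration_matrix_eq[OF u] ..
  also have "\<dots> = Sigma_inv_form ((\<Sigma> - S) *\<^sub>v u) - 4 * Re ((P *\<^sub>v half_step u) \<bullet>c half_step u)"
    using Sigma_inv_form_diff[of P "half_step u"] u by (simp add: half_step_eq)
  also have "Sigma_inv_form ((\<Sigma> - S) *\<^sub>v u) = energy u"
    unfolding energy_def using Sigma_inv_form_diff[of S u] u Re_S_zero by simp
  finally show ?thesis .
qed

lemma energy_iteration_matrix_le: "u \<in> carrier_vec N \<Longrightarrow> energy (iteration_matrix *\<^sub>v u) \<le> energy u"
  using energy_iteration_matrix Re_P_nonneg by simp

lemma energy_iterate_le: "u \<in> carrier_vec N \<Longrightarrow> energy (((*\<^sub>v) iteration_matrix ^^ k) u) \<le> energy u"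
proof (induct k)
  case (Suc k)
  have "((*\<^sub>v) iteration_matrix ^^ k) u \<in> carrier_vec N"
    using mat_vec_iterate_carrier[OF iteration_matrix_carrier Suc(2)] .
  then show ?case using Suc energy_iteration_matrix_le[of "((*\<^sub>v) iteration_matrix ^^ k) u"] by simp
qed simp

lemma energy_add_smult:
  assumes u: "u \<in> carrier_vec N" and d: "d \<in> carrier_vec N"
  obtains K where "\<And>t. energy (u + of_real t \<cdot>\<^sub>v d) = energy u + t * K + t\<^sup>2 * energy d"
proof
  fix t :: real
  have "(\<Sigma> + S) *\<^sub>v (u + of_real t \<cdot>\<^sub>v d) = (\<Sigma> + S) *\<^sub>v u + of_real t \<cdot>\<^sub>v ((\<Sigma> + S) *\<^sub>v d)"
    using u d by (simp add: mult_add_distrib_mat_vec[of _ N N] mult_mat_vec[of _ N N])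
  then show "energy (u + of_real t \<cdot>\<^sub>v d) = energy u + t * Re ((minv \<Sigma> *\<^sub>v ((\<Sigma> + S) *\<^sub>v u)) \<bullet>c ((\<Sigma> + S) *\<^sub>v d)
      + (minv \<Sigma> *\<^sub>v ((\<Sigma> + S) *\<^sub>v d)) \<bullet>c ((\<Sigma> + S) *\<^sub>v u)) + t\<^sup>2 * energy d"
    unfolding energy_def Sigma_inv_form_def using u d by (simp add: Re_quadratic_form_add_smult[of _ N])
qed

lemma iteration_matrix_eigenvector:
  assumes u: "u \<in> carrier_vec N" "u \<noteq> 0\<^sub>v N" and eig: "iteration_matrix *\<^sub>v u = a \<cdot>\<^sub>v u"
  shows "cmod a \<le> 1" and "cmod a = 1 \<Longrightarrow> Re ((P *\<^sub>v half_step u) \<bullet>c half_step u) = 0"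
proof -
  define R where "R = Re ((P *\<^sub>v half_step u) \<bullet>c half_step u)"
  have R: "R \<ge> 0" unfolding R_def using Re_P_nonneg u by simp
  have "energy (a \<cdot>\<^sub>v u) = (cmod a)\<^sup>2 * energy u"
    unfolding energy_def using u by (simp add: mult_mat_vec[of _ N N] Sigma_inv_form_smult)
  then have eq: "(cmod a)\<^sup>2 * energy u = energy u - 4 * R"
    using energy_iteration_matrix[OF u(1)] eig unfolding R_def by simp
  have pos: "energy u > 0" by (rule energy_pos[OF u])
  have "((cmod a)\<^sup>2 - 1) * energy u \<le> 0" using eq R by (simp add: algebra_simps)
  then have "(cmod a)\<^sup>2 \<le> 1" using pos by (simp add: mult_le_0_iff)
  then show "cmod a \<le> 1" by (simp add: power_le_one_iff)
  show "R = 0" if "cmod a = 1" using eq that by simp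
qed

lemma eigenvector_half_step_eqs:
  assumes u: "u \<in> carrier_vec N" and eig: "iteration_matrix *\<^sub>v u = a \<cdot>\<^sub>v u"
  shows "(2 * a) \<cdot>\<^sub>v (\<Sigma> *\<^sub>v u) = (a + 1) \<cdot>\<^sub>v (\<Sigma> *\<^sub>v half_step u) + (a - 1) \<cdot>\<^sub>v (P *\<^sub>v half_step u)"
    and "(2 * a) \<cdot>\<^sub>v (S *\<^sub>v u) = (1 - a) \<cdot>\<^sub>v (\<Sigma> *\<^sub>v half_step u) - (1 + a) \<cdot>\<^sub>v (P *\<^sub>v half_step u)"
proof -
  have h: "half_step u \<in> carrier_vec N" using u by simp
  have "\<Sigma> *\<^sub>v u - S *\<^sub>v u = \<Sigma> *\<^sub>v half_step u + P *\<^sub>v half_step u"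
    using half_step_eq[OF u] u h by (simp add: add_mult_distrib_mat_vec[of _ N N] minus_mult_distrib_mat_vec[of _ N N])
  moreover have "a \<cdot>\<^sub>v (\<Sigma> *\<^sub>v u + S *\<^sub>v u) = \<Sigma> *\<^sub>v half_step u - P *\<^sub>v half_step u"
    using iteration_matrix_eq[OF u] eig u h
    by (simp add: add_mult_distrib_mat_vec[of _ N N] minus_mult_distrib_mat_vec[of _ N N] mult_mat_vec[of _ N N])
  ultimately show "(2 * a) \<cdot>\<^sub>v (\<Sigma> *\<^sub>v u) = (a + 1) \<cdot>\<^sub>v (\<Sigma> *\<^sub>v half_step u) + (a - 1) \<cdot>\<^sub>v (P *\<^sub>v half_step u)"
    and "(2 * a) \<cdot>\<^sub>v (S *\<^sub>v u) = (1 - a) \<cdot>\<^sub>v (\<Sigma> *\<^sub>v half_step u) - (1 + a) \<cdot>\<^sub>v (P *\<^sub>v half_step u)"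
    using solve_sum_diff_vec[of "\<Sigma> *\<^sub>v u" N "S *\<^sub>v u" "\<Sigma> *\<^sub>v half_step u" "P *\<^sub>v half_step u" a] u h by simp_all
qed

lemma iteration_matrix_spectrum:
  assumes unimodular: "\<And>a. eigenvalue iteration_matrix a \<Longrightarrow> cmod a = 1 \<Longrightarrow> a = 1"
    and "eigenvalue iteration_matrix a"
  shows "cmod a < 1 \<or> a = 1"
proof -
  obtain u where "u \<in> carrier_vec N" "u \<noteq> 0\<^sub>v N" "iteration_matrix *\<^sub>v u = a \<cdot>\<^sub>v u"
    using assms(2) unfolding eigenvalue_def eigenvector_def by auto
  then have "cmod a \<le> 1" by (rule iteration_matrix_eigenvector)
  then show ?thesis using unimodular[OF assms(2)] by linarith
qed

text \<open>The eigenvalue \<open>1\<close> is semisimple: along a Jordan chain \<open>\<Gamma> d = d\<close>, \<open>d = \<Gamma> w - w\<close>, the iterates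
  \<open>w + k d\<close> would have energy growing quadratically in \<open>k\<close>, but the energy never increases.\<close>
lemma iteration_matrix_semisimple_one:
  assumes w: "w \<in> carrier_vec N"
    and chain: "iteration_matrix *\<^sub>v (iteration_matrix *\<^sub>v w - w) = iteration_matrix *\<^sub>v w - w"
  shows "iteration_matrix *\<^sub>v w = w"
proof (rule ccontr)
  assume ne: "iteration_matrix *\<^sub>v w \<noteq> w"
  define d where "d = iteration_matrix *\<^sub>v w - w"
  have d: "d \<in> carrier_vec N" unfolding d_def using w by simp
  have "d \<noteq> 0\<^sub>v N" using ne w unfolding d_def by (simp add: vec_diff_eq_zero_iff[of _ N])
  then have ed: "energy d > 0" by (rule energy_pos[OF d])
  have iter: "((*\<^sub>v) iteration_matrix ^^ k) w = w + of_real (real k) \<cdot>\<^sub>v d" for k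
  proof (induct k)
    case 0 then show ?case using w d by (intro eq_vecI) auto
  next
    case (Suc k)
    have "((*\<^sub>v) iteration_matrix ^^ Suc k) w = iteration_matrix *\<^sub>v w + of_real (real k) \<cdot>\<^sub>v d"
      using Suc w d chain by (simp add: mult_add_distrib_mat_vec[of _ N N] mult_mat_vec[of _ N N] d_def[symmetric])
    also have "\<dots> = w + of_real (real (Suc k)) \<cdot>\<^sub>v d"
      using w d by (intro eq_vecI) (auto simp: d_def algebra_simps)
    finally show ?case .
  qed
  obtain K where K: "\<And>t. energy (w + of_real t \<cdot>\<^sub>v d) = energy w + t * K + t\<^sup>2 * energy d"
    using energy_add_smult[OF w d] by blast
  obtain k :: nat where "k * K + (real k)\<^sup>2 * energy d > 0" using quadratic_unbounded_nat[OF ed] by blast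
  with K[of "real k"] energy_iterate_le[OF w, of k] iter[of k] show False by simp
qed

lemma iteration_two_step:
  assumes u: "u \<in> carrier_vec N" and b: "b \<in> carrier_vec N"
  defines "h \<equiv> minv (\<Sigma> + P) *\<^sub>v ((\<Sigma> - S) *\<^sub>v u + b)"
  shows "h \<in> carrier_vec N" and "(\<Sigma> + P) *\<^sub>v h = (\<Sigma> - S) *\<^sub>v u + b"
    and "(\<Sigma> + S) *\<^sub>v (iteration_matrix *\<^sub>v u + iteration_vector b) = (\<Sigma> - P) *\<^sub>v h + b"
proof -
  define w where "w = minv (\<Sigma> + P) *\<^sub>v b"
  have w: "w \<in> carrier_vec N" and Pw: "(\<Sigma> + P) *\<^sub>v w = b"
    unfolding w_def using b by (simp_all add: mult_vec_minv_cancel[of _ N] det_nonzero)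
  show h: "h \<in> carrier_vec N" unfolding h_def using u b by simp
  show "(\<Sigma> + P) *\<^sub>v h = (\<Sigma> - S) *\<^sub>v u + b"
    unfolding h_def using u b by (simp add: mult_vec_minv_cancel[of _ N] det_nonzero)
  have hw: "h = half_step u + w"
    unfolding h_def half_step_def w_def using u b by (simp add: mult_add_distrib_mat_vec[of _ N N])
  have "iteration_vector b = 2 \<cdot>\<^sub>v (minv (\<Sigma> + S) *\<^sub>v (\<Sigma> *\<^sub>v w))"
    unfolding iteration_vector_def w_def using b
    by (simp add: smult_mat_mult_vec[of _ N N] assoc_mult_mat_vec[of _ N N _ N])
  then have "(\<Sigma> + S) *\<^sub>v iteration_vector b = 2 \<cdot>\<^sub>v (\<Sigma> *\<^sub>v w)"
    using w by (simp add: mult_mat_vec[of _ N N] mult_vec_minv_cancel[of _ N] det_nonzero)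
  then have "(\<Sigma> + S) *\<^sub>v (iteration_matrix *\<^sub>v u + iteration_vector b) =
      \<Sigma> *\<^sub>v half_step u - P *\<^sub>v half_step u + 2 \<cdot>\<^sub>v (\<Sigma> *\<^sub>v w)"
    using u b iteration_matrix_eq[OF u]
    by (simp add: mult_add_distrib_mat_vec[of _ N N] minus_mult_distrib_mat_vec[of _ N N] iteration_vector_def)
  also have "\<dots> = (\<Sigma> - P) *\<^sub>v h + b"
    unfolding hw Pw[symmetric] using u w
    by (intro eq_vecI) (simp_all add: mult_add_distrib_mat_vec[of _ N N] minus_mult_distrib_mat_vec[of _ N N]
        add_mult_distrib_mat_vec[of _ N N] algebra_simps)
  finally show "(\<Sigma> + S) *\<^sub>v (iteration_matrix *\<^sub>v u + iteration_vector b) = (\<Sigma> - P) *\<^sub>v h + b" .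
qed

text \<open>With \<open>h\<close> the half step, \<open>(\<Sigma> + S) (\<Gamma> u + c) - (\<Sigma> + S) u = 2 \<Sigma> (h - u)\<close>, so the fixed points of the
  iteration are exactly the vectors whose half step is themselves.\<close>
lemma iteration_fixed_point_iff:
  assumes u: "u \<in> carrier_vec N" and b: "b \<in> carrier_vec N"
  shows "iteration_matrix *\<^sub>v u + iteration_vector b = u \<longleftrightarrow> (P + S) *\<^sub>v u = b"
proof -
  define h where "h = minv (\<Sigma> + P) *\<^sub>v ((\<Sigma> - S) *\<^sub>v u + b)"
  define v where "v = iteration_matrix *\<^sub>v u + iteration_vector b"
  note step = iteration_two_step[OF u b, folded h_def v_def]
  have v: "v \<in> carrier_vec N" unfolding v_def using u b by simp
  have "(\<Sigma> + S) *\<^sub>v v = (\<Sigma> + S) *\<^sub>v u + 2 \<cdot>\<^sub>v (\<Sigma> *\<^sub>v h - \<Sigma> *\<^sub>v u)"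
  proof (intro eq_vecI)
    fix i assume "i < dim_vec ((\<Sigma> + S) *\<^sub>v u + 2 \<cdot>\<^sub>v (\<Sigma> *\<^sub>v h - \<Sigma> *\<^sub>v u))"
    then have i: "i < N" by simp
    from arg_cong[OF step(2), of "\<lambda>x. x $ i"] arg_cong[OF step(3), of "\<lambda>x. x $ i"]
    show "((\<Sigma> + S) *\<^sub>v v) $ i = ((\<Sigma> + S) *\<^sub>v u + 2 \<cdot>\<^sub>v (\<Sigma> *\<^sub>v h - \<Sigma> *\<^sub>v u)) $ i"
      using i u b step(1) v by (simp add: add_mult_distrib_mat_vec[of _ N N] minus_mult_distrib_mat_vec[of _ N N]
          complex_eq_iff)
  qed simp
  moreover have "v = u \<longleftrightarrow> (\<Sigma> + S) *\<^sub>v v = (\<Sigma> + S) *\<^sub>v u"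
    using mult_mat_vec_inj[of "\<Sigma> + S" N v u] det_nonzero u v by auto
  ultimately have "v = u \<longleftrightarrow> \<Sigma> *\<^sub>v h - \<Sigma> *\<^sub>v u = 0\<^sub>v N"
    using u step(1) by (auto simp: vec_eq_iff)
  also have "\<dots> \<longleftrightarrow> h = u"
    using mult_mat_vec_inj[of \<Sigma> N h u] det_nonzero u step(1) by (auto simp: vec_diff_eq_zero_iff[of _ N])
  also have "\<dots> \<longleftrightarrow> (\<Sigma> + P) *\<^sub>v u = (\<Sigma> - S) *\<^sub>v u + b"
    using mult_mat_vec_inj[of "\<Sigma> + P" N h u] det_nonzero u step(1,2) by auto
  also have "\<dots> \<longleftrightarrow> (P + S) *\<^sub>v u = b"
    using u b by (simp add: add_mult_distrib_mat_vec[of _ N N] minus_mult_distrib_mat_vec[of _ N N]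
        vec_eq_iff complex_eq_iff) (auto simp: algebra_simps)
  finally show ?thesis unfolding v_def .
qed

theorem lin_iter_semiconvergent:
  assumes unimodular: "\<And>a. eigenvalue iteration_matrix a \<Longrightarrow> cmod a = 1 \<Longrightarrow> a = 1"
    and b: "b \<in> carrier_vec N" and solvable: "\<exists>u \<in> carrier_vec N. (P + S) *\<^sub>v u = b"
    and u0: "u0 \<in> carrier_vec N"
  shows "\<exists>u \<in> carrier_vec N. (P + S) *\<^sub>v u = b \<and>
    (\<forall>i < N. (\<lambda>k. lin_iter iteration_matrix (iteration_vector b) u0 k $ i) \<longlonglongrightarrow> u $ i)"
proof -
  obtain us where us: "us \<in> carrier_vec N" "(P + S) *\<^sub>v us = b" using solvable by blast
  have fixed: "iteration_matrix *\<^sub>v us + iteration_vector b = us"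
    using iteration_fixed_point_iff[OF us(1) b] us(2) by simp
  define x where "x = u0 - us"
  have x: "x \<in> carrier_vec N" unfolding x_def using u0 us by simp
  obtain L where L: "L \<in> carrier_vec N" "iteration_matrix *\<^sub>v L = L"
    and lim: "\<forall>i<N. (\<lambda>k. ((*\<^sub>v) iteration_matrix ^^ k) x $ i) \<longlonglongrightarrow> L $ i"
    using mat_vec_iterate_converges[OF iteration_matrix_carrier iteration_matrix_spectrum[OF unimodular]
        iteration_matrix_semisimple_one x] by blast
  have "(P + S) *\<^sub>v L = 0\<^sub>v N" using iteration_fixed_point_iff[of L "0\<^sub>v N"] L by simp
  then have sol: "(P + S) *\<^sub>v (L + us) = b"
    using L us b by (simp add: mult_add_distrib_mat_vec[of _ N N])
  have iter: "lin_iter iteration_matrix (iteration_vector b) u0 k = ((*\<^sub>v) iteration_matrix ^^ k) x + us" for k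
  proof (induct k)
    case 0 then show ?case unfolding lin_iter_def x_def using u0 us by (intro eq_vecI) auto
  next
    case (Suc k)
    have xk: "((*\<^sub>v) iteration_matrix ^^ k) x \<in> carrier_vec N" using x by simp
    have "lin_iter iteration_matrix (iteration_vector b) u0 (Suc k) =
        iteration_matrix *\<^sub>v lin_iter iteration_matrix (iteration_vector b) u0 k + iteration_vector b"
      unfolding lin_iter_def by simp
    also have "\<dots> = iteration_matrix *\<^sub>v ((*\<^sub>v) iteration_matrix ^^ k) x + (iteration_matrix *\<^sub>v us + iteration_vector b)"
      unfolding Suc using xk us b by (intro eq_vecI) (auto simp: mult_add_distrib_mat_vec[of _ N N])
    finally show ?case unfolding fixed by simp
  qed
  have "(\<lambda>k. lin_iter iteration_matrix (iteration_vector b) u0 k $ i) \<longlonglongrightarrow> (L + us) $ i" if "i < N" for i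
    using tendsto_add[OF lim[rule_format, OF that] tendsto_const[of "us $ i"]] that x us L
    by (simp add: iter mat_vec_iterate_dim[OF iteration_matrix_carrier x])
  with sol L us show ?thesis by (intro bexI[of _ "L + us"]) auto
qed

end

section \<open>The saddle point splitting\<close>

definition saddle_point_mat :: "complex mat \<Rightarrow> complex mat \<Rightarrow> complex mat \<Rightarrow> complex mat" where
  "saddle_point_mat A B C = four_block_mat A (mat_adjoint B) (- B) C"

lemma saddle_point_mat_carrier [simp]:
  "A \<in> carrier_mat n n \<Longrightarrow> B \<in> carrier_mat m n \<Longrightarrow> C \<in> carrier_mat m m \<Longrightarrow>
    saddle_point_mat A B C \<in> carrier_mat (n + m) (n + m)"
  unfolding saddle_point_mat_def by auto

lemma saddle_point_mat_mult_vec: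
  assumes "A \<in> carrier_mat n n" "B \<in> carrier_mat m n" "C \<in> carrier_mat m m"
    and "x \<in> carrier_vec n" "y \<in> carrier_vec m"
  shows "saddle_point_mat A B C *\<^sub>v (x @\<^sub>v y) = (A *\<^sub>v x + mat_adjoint B *\<^sub>v y) @\<^sub>v (- (B *\<^sub>v x) + C *\<^sub>v y)"
  unfolding saddle_point_mat_def using assms by (simp add: four_block_mat_mult_vec[of _ n n _ m _ m])

lemma saddle_point_mat_add:
  assumes "A \<in> carrier_mat n n" "A' \<in> carrier_mat n n" "B \<in> carrier_mat m n" "B' \<in> carrier_mat m n"
    "C \<in> carrier_mat m m" "C' \<in> carrier_mat m m"
  shows "saddle_point_mat (A + A') (B + B') (C + C') = saddle_point_mat A B C + saddle_point_mat A' B' C'"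
  unfolding saddle_point_mat_def using assms
  by (subst add_four_block_mat[of _ n n _ m _ m]) (auto simp: mat_adjoint_add intro!: cong_four_block_mat)

text \<open>The off-diagonal blocks \<open>B\<^sup>*\<close> and \<open>-B\<close> cancel in the real part of the quadratic form.\<close>
lemma Re_quadratic_form_saddle_point_mat:
  assumes A: "A \<in> carrier_mat n n" and B: "B \<in> carrier_mat m n" and C: "C \<in> carrier_mat m m"
    and x: "x \<in> carrier_vec n" and y: "y \<in> carrier_vec m"
  shows "Re ((saddle_point_mat A B C *\<^sub>v (x @\<^sub>v y)) \<bullet>c (x @\<^sub>v y)) = Re ((A *\<^sub>v x) \<bullet>c x) + Re ((C *\<^sub>v y) \<bullet>c y)"
proof -
  have c: "A *\<^sub>v x \<in> carrier_vec n" "mat_adjoint B *\<^sub>v y \<in> carrier_vec n" "B *\<^sub>v x \<in> carrier_vec m"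
    "C *\<^sub>v y \<in> carrier_vec m" using A B C x y mult_mat_vec_carrier[OF mat_adjoint_carrier[OF B] y] by auto
  have "(saddle_point_mat A B C *\<^sub>v (x @\<^sub>v y)) \<bullet>c (x @\<^sub>v y) =
      (A *\<^sub>v x) \<bullet>c x + (mat_adjoint B *\<^sub>v y) \<bullet>c x + (- (B *\<^sub>v x) \<bullet>c y + (C *\<^sub>v y) \<bullet>c y)"
    using c x y by (simp add: saddle_point_mat_mult_vec[OF A B C x y] cscalar_prod_append[of _ n _ _ m]
        cscalar_prod_add_left[of _ n] cscalar_prod_add_left[of _ m])
  also have "(mat_adjoint B *\<^sub>v y) \<bullet>c x = cnj ((B *\<^sub>v x) \<bullet>c y)"
    using cscalar_prod_mat_adjoint[OF mat_adjoint_carrier[OF B] y x] cscalar_prod_swap[OF y c(3)] by simp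
  also have "- (B *\<^sub>v x) \<bullet>c y = - ((B *\<^sub>v x) \<bullet>c y)" by (rule cscalar_prod_uminus_left[OF c(3) y])
  finally show ?thesis by simp
qed

lemma psd_mat_saddle_point_mat:
  assumes A: "psd_mat n A" and B: "B \<in> carrier_mat m n" and C: "psd_mat m C"
  shows "psd_mat (n + m) (saddle_point_mat A B C)"
  unfolding psd_mat_iff_Re
proof (intro conjI ballI)
  have A': "A \<in> carrier_mat n n" and C': "C \<in> carrier_mat m m" using A C unfolding psd_mat_def by auto
  then show "saddle_point_mat A B C \<in> carrier_mat (n + m) (n + m)" using B by simp
  fix z :: "complex vec" assume z: "z \<in> carrier_vec (n + m)"
  then have "z = vec_first z n @\<^sub>v vec_last z m" by simp
  then show "Re ((saddle_point_mat A B C *\<^sub>v z) \<bullet>c z) \<ge> 0"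
    using Re_quadratic_form_saddle_point_mat[OF A' B C', of "vec_first z n" "vec_last z m"] A C
    unfolding psd_mat_iff_Re by (metis add_nonneg_nonneg vec_first_carrier vec_last_carrier)
qed

lemma saddle_point_mat_isotropic:
  assumes A: "pd_mat n A" and B: "B \<in> carrier_mat m n" and C: "psd_mat m C"
    and z: "z \<in> carrier_vec (n + m)" and zero: "Re ((saddle_point_mat A B C *\<^sub>v z) \<bullet>c z) = 0"
  shows "vec_first z n = 0\<^sub>v n" and "(C + mat_adjoint C) *\<^sub>v vec_last z m = 0\<^sub>v m"
proof -
  have A': "A \<in> carrier_mat n n" and C': "C \<in> carrier_mat m m"
    using A C unfolding pd_mat_def psd_mat_def by auto
  have "Re ((A *\<^sub>v vec_first z n) \<bullet>c vec_first z n) + Re ((C *\<^sub>v vec_last z m) \<bullet>c vec_last z m) = 0"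
    using zero Re_quadratic_form_saddle_point_mat[OF A' B C', of "vec_first z n" "vec_last z m"] z by simp
  moreover have "Re ((A *\<^sub>v vec_first z n) \<bullet>c vec_first z n) \<ge> 0" "Re ((C *\<^sub>v vec_last z m) \<bullet>c vec_last z m) \<ge> 0"
    using pd_mat_imp_psd_mat[OF A] C unfolding psd_mat_iff_Re by auto
  ultimately have "Re ((A *\<^sub>v vec_first z n) \<bullet>c vec_first z n) = 0" "Re ((C *\<^sub>v vec_last z m) \<bullet>c vec_last z m) = 0"
    by linarith+
  then show "vec_first z n = 0\<^sub>v n" and "(C + mat_adjoint C) *\<^sub>v vec_last z m = 0\<^sub>v m"
    using A psd_mat_isotropic_kernel[OF C] unfolding pd_mat_iff_Re by (metis less_irrefl vec_first_carrier,
      simp)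
qed

lemma skew_herm_mat_saddle_point_mat:
  assumes A: "skew_herm_mat n A" and B: "B \<in> carrier_mat m n" and C: "skew_herm_mat m C"
  shows "skew_herm_mat (n + m) (saddle_point_mat A B C)"
proof -
  have A': "A \<in> carrier_mat n n" "mat_adjoint A = - A" and C': "C \<in> carrier_mat m m" "mat_adjoint C = - C"
    using A C unfolding skew_herm_mat_def by auto
  have "mat_adjoint (saddle_point_mat A B C) = - saddle_point_mat A B C"
    unfolding saddle_point_mat_def using A' B C'
    by (subst mat_adjoint_four_block_mat[of _ n n _ m _ m]) (auto intro!: eq_matI)
  with A' B C' show ?thesis unfolding skew_herm_mat_def by simp
qed

lemma hpd_mat_block_diag:
  assumes Pa: "hpd_mat n P\<^sub>\<alpha>" and Pb: "hpd_mat m P\<^sub>\<beta>"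
  shows "hpd_mat (n + m) (four_block_mat P\<^sub>\<alpha> (0\<^sub>m n m) (0\<^sub>m m n) P\<^sub>\<beta>)"
  unfolding hpd_mat_def
proof (intro conjI ballI impI)
  have Pa': "P\<^sub>\<alpha> \<in> carrier_mat n n" "mat_adjoint P\<^sub>\<alpha> = P\<^sub>\<alpha>"
    and Pb': "P\<^sub>\<beta> \<in> carrier_mat m m" "mat_adjoint P\<^sub>\<beta> = P\<^sub>\<beta>"
    using Pa Pb unfolding hpd_mat_def by auto
  then show "four_block_mat P\<^sub>\<alpha> (0\<^sub>m n m) (0\<^sub>m m n) P\<^sub>\<beta> \<in> carrier_mat (n + m) (n + m)" by auto
  show "mat_adjoint (four_block_mat P\<^sub>\<alpha> (0\<^sub>m n m) (0\<^sub>m m n) P\<^sub>\<beta>) = four_block_mat P\<^sub>\<alpha> (0\<^sub>m n m) (0\<^sub>m m n) P\<^sub>\<beta>"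
    using Pa' Pb' by (simp add: mat_adjoint_four_block_mat[of _ n n _ m _ m])
  fix z :: "complex vec" assume z: "z \<in> carrier_vec (n + m)" "z \<noteq> 0\<^sub>v (n + m)"
  define x y where "x = vec_first z n" and "y = vec_last z m"
  have x: "x \<in> carrier_vec n" and y: "y \<in> carrier_vec m" and zxy: "z = x @\<^sub>v y"
    unfolding x_def y_def using z by auto
  have "(four_block_mat P\<^sub>\<alpha> (0\<^sub>m n m) (0\<^sub>m m n) P\<^sub>\<beta> *\<^sub>v z) \<bullet>c z = (P\<^sub>\<alpha> *\<^sub>v x) \<bullet>c x + (P\<^sub>\<beta> *\<^sub>v y) \<bullet>c y"
    unfolding zxy using Pa' Pb' x y by (simp add: mult_mat_vec_split cscalar_prod_append[of _ n _ _ m])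
  moreover have "x \<noteq> 0\<^sub>v n \<or> y \<noteq> 0\<^sub>v m" using z zxy by auto
  moreover have "Re ((P\<^sub>\<alpha> *\<^sub>v x) \<bullet>c x) \<ge> 0" "Re ((P\<^sub>\<beta> *\<^sub>v y) \<bullet>c y) \<ge> 0"
    using pd_mat_imp_psd_mat[unfolded pd_mat_iff_Re psd_mat_iff_Re] Pa Pb x y unfolding hpd_mat_def by blast+
  ultimately show "Re ((four_block_mat P\<^sub>\<alpha> (0\<^sub>m n m) (0\<^sub>m m n) P\<^sub>\<beta> *\<^sub>v z) \<bullet>c z) > 0"
    using Pa Pb x y unfolding hpd_mat_def by fastforce
qed

text \<open>Eliminating the first block of an eigenvector of the iteration matrix leaves a relation in the
  second block alone; it is the source of the spectral condition on \<open>P\<^sub>\<beta> - B\<^sub>S P\<^sub>\<alpha>\<inverse> B\<^sub>P\<^sup>* + C\<^sub>S P\<^sub>\<beta>\<inverse> C\<^sub>P\<close>.\<close>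
lemma saddle_point_eigen_reduction:
  fixes P\<^sub>\<alpha> P\<^sub>\<beta> B\<^sub>P B\<^sub>S C\<^sub>P C\<^sub>S :: "complex mat"
  assumes Pa: "P\<^sub>\<alpha> \<in> carrier_mat n n" "det P\<^sub>\<alpha> \<noteq> 0" and Pb: "P\<^sub>\<beta> \<in> carrier_mat m m" "det P\<^sub>\<beta> \<noteq> 0"
    and BP: "B\<^sub>P \<in> carrier_mat m n" and BS: "B\<^sub>S \<in> carrier_mat m n"
    and CP: "C\<^sub>P \<in> carrier_mat m m" and CS: "C\<^sub>S \<in> carrier_mat m m"
    and ux: "ux \<in> carrier_vec n" and uy: "uy \<in> carrier_vec m" and y: "y \<in> carrier_vec m"
    and h1: "(2 * a) \<cdot>\<^sub>v (P\<^sub>\<alpha> *\<^sub>v ux) = (a - 1) \<cdot>\<^sub>v (mat_adjoint B\<^sub>P *\<^sub>v y)"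
    and h2: "(2 * a) \<cdot>\<^sub>v (P\<^sub>\<beta> *\<^sub>v uy) = (a + 1) \<cdot>\<^sub>v (P\<^sub>\<beta> *\<^sub>v y) + (a - 1) \<cdot>\<^sub>v (C\<^sub>P *\<^sub>v y)"
    and h3: "(2 * a) \<cdot>\<^sub>v (- (B\<^sub>S *\<^sub>v ux) + C\<^sub>S *\<^sub>v uy) = (1 - a) \<cdot>\<^sub>v (P\<^sub>\<beta> *\<^sub>v y) - (1 + a) \<cdot>\<^sub>v (C\<^sub>P *\<^sub>v y)"
  shows "(1 - a) \<cdot>\<^sub>v ((P\<^sub>\<beta> - B\<^sub>S * minv P\<^sub>\<alpha> * mat_adjoint B\<^sub>P + C\<^sub>S * minv P\<^sub>\<beta> * C\<^sub>P) *\<^sub>v y) =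
    (1 + a) \<cdot>\<^sub>v ((C\<^sub>P + C\<^sub>S) *\<^sub>v y)"
proof -
  define X Z where "X = B\<^sub>S * minv P\<^sub>\<alpha> * mat_adjoint B\<^sub>P" and "Z = C\<^sub>S * minv P\<^sub>\<beta> * C\<^sub>P"
  have X: "X \<in> carrier_mat m m" and Z: "Z \<in> carrier_mat m m"
    unfolding X_def Z_def using minv_carrier[OF Pa] minv_carrier[OF Pb] BP BS CP CS by auto
  have By: "mat_adjoint B\<^sub>P *\<^sub>v y \<in> carrier_vec n" using mult_mat_vec_carrier[OF mat_adjoint_carrier[OF BP] y] .
  have Pa': "minv P\<^sub>\<alpha> \<in> carrier_mat n n" and Pb': "minv P\<^sub>\<beta> \<in> carrier_mat m m"
    using minv_carrier Pa Pb by auto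
  have ux': "(2 * a) \<cdot>\<^sub>v ux = (a - 1) \<cdot>\<^sub>v (minv P\<^sub>\<alpha> *\<^sub>v (mat_adjoint B\<^sub>P *\<^sub>v y))"
    using arg_cong[OF h1, of "(*\<^sub>v) (minv P\<^sub>\<alpha>)"] Pa' Pa ux By
    by (simp add: mult_mat_vec[of _ n n] minv_mult_vec_cancel[of _ n])
  have "(2 * a) \<cdot>\<^sub>v (B\<^sub>S *\<^sub>v ux) = B\<^sub>S *\<^sub>v ((2 * a) \<cdot>\<^sub>v ux)" by (rule mult_mat_vec[OF BS ux, symmetric])
  also have "\<dots> = (a - 1) \<cdot>\<^sub>v (X *\<^sub>v y)"
    unfolding ux' X_def using BS Pa' BP By y
      assoc_mult_mat_vec[OF mult_carrier_mat[OF BS Pa'] mat_adjoint_carrier[OF BP] y]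
      assoc_mult_mat_vec[OF BS Pa' By] by (simp add: mult_mat_vec[of _ m n])
  finally have Bux: "(2 * a) \<cdot>\<^sub>v (B\<^sub>S *\<^sub>v ux) = (a - 1) \<cdot>\<^sub>v (X *\<^sub>v y)" .
  have uy': "(2 * a) \<cdot>\<^sub>v uy = (a + 1) \<cdot>\<^sub>v y + (a - 1) \<cdot>\<^sub>v (minv P\<^sub>\<beta> *\<^sub>v (C\<^sub>P *\<^sub>v y))"
    using arg_cong[OF h2, of "(*\<^sub>v) (minv P\<^sub>\<beta>)"] Pb' Pb uy y CP
    by (simp add: mult_mat_vec[of _ m m] mult_add_distrib_mat_vec[of _ m m] minv_mult_vec_cancel[of _ m])
  have "(2 * a) \<cdot>\<^sub>v (C\<^sub>S *\<^sub>v uy) = C\<^sub>S *\<^sub>v ((2 * a) \<cdot>\<^sub>v uy)" by (rule mult_mat_vec[OF CS uy, symmetric])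
  also have "\<dots> = (a + 1) \<cdot>\<^sub>v (C\<^sub>S *\<^sub>v y) + (a - 1) \<cdot>\<^sub>v (Z *\<^sub>v y)"
    unfolding uy' Z_def using CS Pb' CP y
      assoc_mult_mat_vec[OF mult_carrier_mat[OF CS Pb'] CP y]
      assoc_mult_mat_vec[OF CS Pb' mult_mat_vec_carrier[OF CP y]]
    by (simp add: mult_mat_vec[of _ m m] mult_add_distrib_mat_vec[of _ m m])
  finally have Cuy: "(2 * a) \<cdot>\<^sub>v (C\<^sub>S *\<^sub>v uy) = (a + 1) \<cdot>\<^sub>v (C\<^sub>S *\<^sub>v y) + (a - 1) \<cdot>\<^sub>v (Z *\<^sub>v y)" .
  show ?thesis unfolding X_def[symmetric] Z_def[symmetric]
  proof (intro eq_vecI)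
    fix i assume "i < dim_vec ((1 + a) \<cdot>\<^sub>v ((C\<^sub>P + C\<^sub>S) *\<^sub>v y))"
    then have i: "i < m" using CP CS by simp
    have "(2 * a) * (B\<^sub>S *\<^sub>v ux) $ i = (a - 1) * (X *\<^sub>v y) $ i"
      "(2 * a) * (C\<^sub>S *\<^sub>v uy) $ i = (a + 1) * (C\<^sub>S *\<^sub>v y) $ i + (a - 1) * (Z *\<^sub>v y) $ i"
      "(2 * a) * (- (B\<^sub>S *\<^sub>v ux) $ i + (C\<^sub>S *\<^sub>v uy) $ i) = (1 - a) * (P\<^sub>\<beta> *\<^sub>v y) $ i - (1 + a) * (C\<^sub>P *\<^sub>v y) $ i"
      using arg_cong[OF Bux, of "\<lambda>v. v $ i"] arg_cong[OF Cuy, of "\<lambda>v. v $ i"] arg_cong[OF h3, of "\<lambda>v. v $ i"]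
        i BS CS Pb CP X Z by simp_all
    then show "((1 - a) \<cdot>\<^sub>v ((P\<^sub>\<beta> - X + Z) *\<^sub>v y)) $ i = ((1 + a) \<cdot>\<^sub>v ((C\<^sub>P + C\<^sub>S) *\<^sub>v y)) $ i"
      using i Pb X Z CP CS y by (simp add: add_mult_distrib_mat_vec[of _ m m] minus_mult_distrib_mat_vec[of _ m m])
        Groebner_Basis.algebra
  qed (use Pb X Z CP CS in simp)
qed

locale saddle_point_splitting =
  fixes n m :: nat and A\<^sub>P A\<^sub>S B\<^sub>P B\<^sub>S C\<^sub>P C\<^sub>S P\<^sub>\<alpha> P\<^sub>\<beta> :: "complex mat"
  assumes AP: "pd_mat n A\<^sub>P" and AS: "skew_herm_mat n A\<^sub>S"
    and CP: "psd_mat m C\<^sub>P" and CS: "skew_herm_mat m C\<^sub>S"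
    and BP: "B\<^sub>P \<in> carrier_mat m n" and BS: "B\<^sub>S \<in> carrier_mat m n"
    and Pa: "hpd_mat n P\<^sub>\<alpha>" and Pb: "hpd_mat m P\<^sub>\<beta>"
begin

abbreviation "\<Sigma> \<equiv> four_block_mat P\<^sub>\<alpha> (0\<^sub>m n m) (0\<^sub>m m n) P\<^sub>\<beta>"

abbreviation "\<P> \<equiv> saddle_point_mat A\<^sub>P B\<^sub>P C\<^sub>P"

abbreviation "\<S> \<equiv> saddle_point_mat A\<^sub>S B\<^sub>S C\<^sub>S"

sublocale splitting_iteration "n + m" \<Sigma> \<P> \<S>
  using hpd_mat_block_diag[OF Pa Pb] psd_mat_saddle_point_mat[OF pd_mat_imp_psd_mat[OF AP] BP CP]
    skew_herm_mat_saddle_point_mat[OF AS BS CS] by unfold_locales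

lemma block_carriers:
  "A\<^sub>P \<in> carrier_mat n n" "A\<^sub>S \<in> carrier_mat n n" "C\<^sub>P \<in> carrier_mat m m" "C\<^sub>S \<in> carrier_mat m m"
  "P\<^sub>\<alpha> \<in> carrier_mat n n" "P\<^sub>\<beta> \<in> carrier_mat m m"
  using AP AS CP CS Pa Pb unfolding pd_mat_def skew_herm_mat_def psd_mat_def hpd_mat_def by auto

lemma eigenvector_block_equations:
  assumes u: "u \<in> carrier_vec (n + m)" and eig: "iteration_matrix *\<^sub>v u = a \<cdot>\<^sub>v u"
    and y: "y \<in> carrier_vec m" and h: "half_step u = 0\<^sub>v n @\<^sub>v y"
  defines "ux \<equiv> vec_first u n" and "uy \<equiv> vec_last u m"
  shows "(2 * a) \<cdot>\<^sub>v (P\<^sub>\<alpha> *\<^sub>v ux) = (a - 1) \<cdot>\<^sub>v (mat_adjoint B\<^sub>P *\<^sub>v y)"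
    and "(2 * a) \<cdot>\<^sub>v (P\<^sub>\<beta> *\<^sub>v uy) = (a + 1) \<cdot>\<^sub>v (P\<^sub>\<beta> *\<^sub>v y) + (a - 1) \<cdot>\<^sub>v (C\<^sub>P *\<^sub>v y)"
    and "(2 * a) \<cdot>\<^sub>v (- (B\<^sub>S *\<^sub>v ux) + C\<^sub>S *\<^sub>v uy) = (1 - a) \<cdot>\<^sub>v (P\<^sub>\<beta> *\<^sub>v y) - (1 + a) \<cdot>\<^sub>v (C\<^sub>P *\<^sub>v y)"
proof -
  note c = block_carriers BP BS
  define sx sy where "sx = A\<^sub>S *\<^sub>v ux + mat_adjoint B\<^sub>S *\<^sub>v uy" and "sy = - (B\<^sub>S *\<^sub>v ux) + C\<^sub>S *\<^sub>v uy"
  have ux: "ux \<in> carrier_vec n" and uy: "uy \<in> carrier_vec m" and uxy: "u = ux @\<^sub>v uy"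
    unfolding ux_def uy_def using u by auto
  have By: "mat_adjoint B\<^sub>P *\<^sub>v y \<in> carrier_vec n" "mat_adjoint B\<^sub>S *\<^sub>v uy \<in> carrier_vec n"
    using mult_mat_vec_carrier[OF mat_adjoint_carrier[OF BP] y] mult_mat_vec_carrier[OF mat_adjoint_carrier[OF BS] uy] .
  have sx: "sx \<in> carrier_vec n" and sy: "sy \<in> carrier_vec m" unfolding sx_def sy_def using c ux uy By by auto
  have "\<Sigma> *\<^sub>v u = (P\<^sub>\<alpha> *\<^sub>v ux) @\<^sub>v (P\<^sub>\<beta> *\<^sub>v uy)" unfolding uxy by (rule mult_mat_vec_split[OF c(5,6) ux uy])
  moreover have "\<S> *\<^sub>v u = sx @\<^sub>v sy" unfolding uxy sx_def sy_def by (rule saddle_point_mat_mult_vec[OF c(2) BS c(4) ux uy])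
  moreover have "\<Sigma> *\<^sub>v half_step u = 0\<^sub>v n @\<^sub>v (P\<^sub>\<beta> *\<^sub>v y)"
    unfolding h using mult_mat_vec_split[OF c(5,6) zero_carrier_vec y] c by simp
  moreover have "\<P> *\<^sub>v half_step u = (mat_adjoint B\<^sub>P *\<^sub>v y) @\<^sub>v (C\<^sub>P *\<^sub>v y)"
    unfolding h using saddle_point_mat_mult_vec[OF c(1) BP c(3) zero_carrier_vec y] c By y
    by (simp add: mult_mat_vec_zero[OF BP])
  ultimately have "((2 * a) \<cdot>\<^sub>v (P\<^sub>\<alpha> *\<^sub>v ux)) @\<^sub>v ((2 * a) \<cdot>\<^sub>v (P\<^sub>\<beta> *\<^sub>v uy)) =
      ((a - 1) \<cdot>\<^sub>v (mat_adjoint B\<^sub>P *\<^sub>v y)) @\<^sub>v ((a + 1) \<cdot>\<^sub>v (P\<^sub>\<beta> *\<^sub>v y) + (a - 1) \<cdot>\<^sub>v (C\<^sub>P *\<^sub>v y))"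
    and "((2 * a) \<cdot>\<^sub>v sx) @\<^sub>v ((2 * a) \<cdot>\<^sub>v sy) =
      (- ((1 + a) \<cdot>\<^sub>v (mat_adjoint B\<^sub>P *\<^sub>v y))) @\<^sub>v ((1 - a) \<cdot>\<^sub>v (P\<^sub>\<beta> *\<^sub>v y) - (1 + a) \<cdot>\<^sub>v (C\<^sub>P *\<^sub>v y))"
    using eigenvector_half_step_eqs[OF u eig] c ux uy sx sy y By
    by (simp_all add: smult_append_vec[of _ n _ m] append_vec_add[of _ n _ _ m] append_vec_diff[of _ n _ _ m])
  then show "(2 * a) \<cdot>\<^sub>v (P\<^sub>\<alpha> *\<^sub>v ux) = (a - 1) \<cdot>\<^sub>v (mat_adjoint B\<^sub>P *\<^sub>v y)"
    and "(2 * a) \<cdot>\<^sub>v (P\<^sub>\<beta> *\<^sub>v uy) = (a + 1) \<cdot>\<^sub>v (P\<^sub>\<beta> *\<^sub>v y) + (a - 1) \<cdot>\<^sub>v (C\<^sub>P *\<^sub>v y)"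
    and "(2 * a) \<cdot>\<^sub>v (- (B\<^sub>S *\<^sub>v ux) + C\<^sub>S *\<^sub>v uy) = (1 - a) \<cdot>\<^sub>v (P\<^sub>\<beta> *\<^sub>v y) - (1 + a) \<cdot>\<^sub>v (C\<^sub>P *\<^sub>v y)"
    unfolding sy_def[symmetric] using c ux sx By by (simp_all add: append_vec_eq[of _ n])
qed

lemma unimodular_eigenvalue_witness:
  assumes eig: "eigenvalue iteration_matrix a" and unit: "cmod a = 1" and a1: "a \<noteq> 1"
  obtains r where "r \<in> carrier_vec m" "r \<noteq> 0\<^sub>v m" "(C\<^sub>P + mat_adjoint C\<^sub>P) *\<^sub>v r = 0\<^sub>v m"
    "(P\<^sub>\<beta> - B\<^sub>S * minv P\<^sub>\<alpha> * mat_adjoint B\<^sub>P + C\<^sub>S * minv P\<^sub>\<beta> * C\<^sub>P) *\<^sub>v r =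
      ((1 + a) / (1 - a)) \<cdot>\<^sub>v ((C\<^sub>P + C\<^sub>S) *\<^sub>v r)"
proof -
  note c = block_carriers BP BS
  obtain u where u: "u \<in> carrier_vec (n + m)" "u \<noteq> 0\<^sub>v (n + m)" "iteration_matrix *\<^sub>v u = a \<cdot>\<^sub>v u"
    using eig unfolding eigenvalue_def eigenvector_def by auto
  define y where "y = vec_last (half_step u) m"
  have "Re ((\<P> *\<^sub>v half_step u) \<bullet>c half_step u) = 0" by (rule iteration_matrix_eigenvector(2)[OF u unit])
  note isotropic = saddle_point_mat_isotropic[OF AP BP CP half_step_carrier[OF u(1)] this]
  have y: "y \<in> carrier_vec m" unfolding y_def by simp
  have h: "half_step u = 0\<^sub>v n @\<^sub>v y"
    unfolding y_def isotropic(1)[symmetric] using half_step_carrier[OF u(1)] by simp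
  have "y \<noteq> 0\<^sub>v m" using half_step_nonzero[OF u(1,2)] h by auto
  moreover have "(C\<^sub>P + mat_adjoint C\<^sub>P) *\<^sub>v y = 0\<^sub>v m" using isotropic(2) unfolding y_def .
  moreover note eqs = eigenvector_block_equations[OF u(1,3) y h]
  have "(1 - a) \<cdot>\<^sub>v ((P\<^sub>\<beta> - B\<^sub>S * minv P\<^sub>\<alpha> * mat_adjoint B\<^sub>P + C\<^sub>S * minv P\<^sub>\<beta> * C\<^sub>P) *\<^sub>v y) =
      (1 + a) \<cdot>\<^sub>v ((C\<^sub>P + C\<^sub>S) *\<^sub>v y)"
    using c u(1) y hpd_mat_det_nonzero[OF Pa] hpd_mat_det_nonzero[OF Pb]
    by (intro saddle_point_eigen_reduction[OF _ _ _ _ BP BS _ _ _ _ y eqs]) auto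
  then have "(P\<^sub>\<beta> - B\<^sub>S * minv P\<^sub>\<alpha> * mat_adjoint B\<^sub>P + C\<^sub>S * minv P\<^sub>\<beta> * C\<^sub>P) *\<^sub>v y =
      ((1 + a) / (1 - a)) \<cdot>\<^sub>v ((C\<^sub>P + C\<^sub>S) *\<^sub>v y)"
    using a1 by (intro smult_vec_eq_imp_eq_divide) auto
  ultimately show ?thesis using that y by blast
qed

lemma unimodular_eigenvalue_eq_one:
  assumes spectral: "\<And>\<mu> r. eigenvalue iteration_matrix \<mu> \<Longrightarrow> cmod \<mu> = 1 \<Longrightarrow> \<mu> \<noteq> 1 \<Longrightarrow>
      r \<in> carrier_vec m \<Longrightarrow> r \<noteq> 0\<^sub>v m \<Longrightarrow> ((C\<^sub>P + C\<^sub>S) + mat_adjoint (C\<^sub>P + C\<^sub>S)) *\<^sub>v r = 0\<^sub>v m \<Longrightarrow>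
      ((P\<^sub>\<beta> - B\<^sub>S * minv P\<^sub>\<alpha> * mat_adjoint B\<^sub>P + C\<^sub>S * minv P\<^sub>\<beta> * C\<^sub>P) *\<^sub>v r) \<bullet>c r
        \<noteq> (1 + \<mu>) / (1 - \<mu>) * (((C\<^sub>P + C\<^sub>S) *\<^sub>v r) \<bullet>c r)"
    and eig: "eigenvalue iteration_matrix a" and unit: "cmod a = 1"
  shows "a = 1"
proof (rule ccontr)
  assume a1: "a \<noteq> 1"
  obtain r where r: "r \<in> carrier_vec m" "r \<noteq> 0\<^sub>v m" "(C\<^sub>P + mat_adjoint C\<^sub>P) *\<^sub>v r = 0\<^sub>v m"
    and rel: "(P\<^sub>\<beta> - B\<^sub>S * minv P\<^sub>\<alpha> * mat_adjoint B\<^sub>P + C\<^sub>S * minv P\<^sub>\<beta> * C\<^sub>P) *\<^sub>v r =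
      ((1 + a) / (1 - a)) \<cdot>\<^sub>v ((C\<^sub>P + C\<^sub>S) *\<^sub>v r)"
    using unimodular_eigenvalue_witness[OF eig unit a1] by blast
  have "((C\<^sub>P + C\<^sub>S) + mat_adjoint (C\<^sub>P + C\<^sub>S)) *\<^sub>v r = 0\<^sub>v m"
    using r(3) herm_part_add_skew_herm[OF block_carriers(3) CS] by simp
  moreover have "((P\<^sub>\<beta> - B\<^sub>S * minv P\<^sub>\<alpha> * mat_adjoint B\<^sub>P + C\<^sub>S * minv P\<^sub>\<beta> * C\<^sub>P) *\<^sub>v r) \<bullet>c r =
      (1 + a) / (1 - a) * (((C\<^sub>P + C\<^sub>S) *\<^sub>v r) \<bullet>c r)"
    unfolding rel using r(1) block_carriers by (simp add: cscalar_prod_smult_left[of _ m])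
  ultimately show False using spectral[OF eig unit a1 r(1,2)] by blast
qed

end

theorem theorem1:
  fixes n m :: nat
    and A A\<^sub>P A\<^sub>S P\<^sub>\<alpha> :: "complex mat"
    and C C\<^sub>P C\<^sub>S P\<^sub>\<beta> :: "complex mat"
    and B B\<^sub>P B\<^sub>S :: "complex mat"
    and b :: "complex vec"
  defines "\<A> \<equiv> four_block_mat A (mat_adjoint B) (- B) C"
    and "\<P> \<equiv> four_block_mat A\<^sub>P (mat_adjoint B\<^sub>P) (- B\<^sub>P) C\<^sub>P"
    and "\<S> \<equiv> four_block_mat A\<^sub>S (mat_adjoint B\<^sub>S) (- B\<^sub>S) C\<^sub>S"
    and "\<Sigma> \<equiv> four_block_mat P\<^sub>\<alpha> (0\<^sub>m n m) (0\<^sub>m m n) P\<^sub>\<beta>"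
  defines "\<Gamma> \<equiv> minv (\<Sigma> + \<S>) * (\<Sigma> - \<P>) * minv (\<Sigma> + \<P>) * (\<Sigma> - \<S>)"
    and "c \<equiv> (2 \<cdot>\<^sub>m (minv (\<Sigma> + \<S>) * \<Sigma> * minv (\<Sigma> + \<P>))) *\<^sub>v b"
  assumes mn: "m \<le> n"
    and A: "pd_mat n A" and C: "psd_mat m C" and B: "B \<in> carrier_mat m n"
    and sing: "det \<A> = 0"
    and b: "b \<in> carrier_vec (n + m)"
    and consistent: "\<exists>u \<in> carrier_vec (n + m). \<A> *\<^sub>v u = b"
    and splitA: "A = A\<^sub>P + A\<^sub>S" and AP: "pd_mat n A\<^sub>P" and AS: "skew_herm_mat n A\<^sub>S"
    and splitC: "C = C\<^sub>P + C\<^sub>S" and CP: "psd_mat m C\<^sub>P" and CS: "skew_herm_mat m C\<^sub>S"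
    and splitB: "B = B\<^sub>P + B\<^sub>S" and BP: "B\<^sub>P \<in> carrier_mat m n" and BS: "B\<^sub>S \<in> carrier_mat m n"
    and Pa: "hpd_mat n P\<^sub>\<alpha>" and Pb: "hpd_mat m P\<^sub>\<beta>"
    and cond: "\<forall>\<mu> \<in> spectrum \<Gamma>. cmod \<mu> = 1 \<and> \<mu> \<noteq> 1 \<longrightarrow>
        (\<forall>r \<in> carrier_vec m. r \<noteq> 0\<^sub>v m \<and> (C + mat_adjoint C) *\<^sub>v r = 0\<^sub>v m \<longrightarrow>
          ((P\<^sub>\<beta> - B\<^sub>S * minv P\<^sub>\<alpha> * mat_adjoint B\<^sub>P + C\<^sub>S * minv P\<^sub>\<beta> * C\<^sub>P) *\<^sub>v r) \<bullet>c r
            \<noteq> (1 + \<mu>) / (1 - \<mu>) * ((C *\<^sub>v r) \<bullet>c r))"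
  shows "\<forall>u0 \<in> carrier_vec (n + m). \<exists>u \<in> carrier_vec (n + m). \<A> *\<^sub>v u = b \<and>
           (\<forall>i < n + m. (\<lambda>k. lin_iter \<Gamma> c u0 k $ i) \<longlonglongrightarrow> u $ i)"
proof
  fix u0 :: "complex vec" assume u0: "u0 \<in> carrier_vec (n + m)"
  interpret saddle_point_splitting n m A\<^sub>P A\<^sub>S B\<^sub>P B\<^sub>S C\<^sub>P C\<^sub>S P\<^sub>\<alpha> P\<^sub>\<beta>
    using AP AS CP CS BP BS Pa Pb by unfold_locales
  have P: "\<P> = saddle_point_mat A\<^sub>P B\<^sub>P C\<^sub>P" and S: "\<S> = saddle_point_mat A\<^sub>S B\<^sub>S C\<^sub>S"
    unfolding \<P>_def \<S>_def saddle_point_mat_def by simp_all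
  have "\<A> = \<P> + \<S>"
    unfolding \<A>_def P S splitA splitB splitC saddle_point_mat_def[symmetric]
    by (rule saddle_point_mat_add[OF block_carriers(1,2) BP BS block_carriers(3,4)])
  moreover have \<Gamma>: "\<Gamma> = iteration_matrix" and "c = iteration_vector b"
    unfolding \<Gamma>_def c_def iteration_matrix_def iteration_vector_def P S \<Sigma>_def by simp_all
  moreover have "a = 1" if "eigenvalue iteration_matrix a" "cmod a = 1" for a
    using unimodular_eigenvalue_eq_one[OF _ that] cond unfolding \<Gamma> spectrum_def splitC by blast
  ultimately show "\<exists>u \<in> carrier_vec (n + m). \<A> *\<^sub>v u = b \<and> (\<forall>i < n + m. (\<lambda>k. lin_iter \<Gamma> c u0 k $ i) \<longlonglongrightarrow> u $ i)"
    using lin_iter_semiconvergent[OF _ b _ u0] consistent by (simp add: P S)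
qed

end
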